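(* Let $\mathcal{C}$ be a finitely complete $\mathbf{Ord}$-category and let $(\mathsf{L},\mathsf{R})$ be a sub-LARI lax orthogonal factorisation system (LOFS) on $\mathcal{C}$. Then the following statements are equivalent: (1) $(\mathsf{L},\mathsf{R})$ is cancellative; (2) $(\mathsf{L},\mathsf{R})$ is (KZ-)reflective.
   Context: $\mathbf{Ord}$ is the category of posets and monotone maps. An $\mathbf{Ord}$-category is a locally small category whose hom-sets are posets and whose composition is monotone in each variable; an $\mathbf{Ord}$-functor is a functor that is monotone on hom-posets; an $\mathbf{Ord}$-monad (comonad) is a monad (comonad) whose underlying functor is an $\mathbf{Ord}$-functor. Limits (in particular comma-objects and finite limits) are understood in the $\mathbf{Ord}$-enriched sense. $\mathcal{C}^{\mathbf 2}$ is the arrow category: morphisms $f\to g$ are pairs $(h,k)$ with $g\cdot h=k\cdot f$, and $(h,k)\le(h',k')$ iff $h\le h'$ and $k\le k'$. Categories of (co)algebras are $\mathbf{Ord}$-categories with the order on morphisms inherited from the base. An $\mathbf{Ord}$-monad $(T,\eta,\mu)$ is lax idempotent if $T\eta\le\eta T$; an $\mathbf{Ord}$-comonad $(G,\varepsilon,\delta)$ is lax idempotent if $G\varepsilon\le\varepsilon G$. An ($\mathbf{Ord}$-enriched) algebraic weak factorisation system (AWFS) $(\mathsf{L},\mathsf{R})$ on $\mathcal{C}$ consists of an $\mathbf{Ord}$-functorial factorisation $f=Rf\cdot Lf$, $X\xrightarrow{Lf}Kf\xrightarrow{Rf}Y$, with $K\colon\mathcal{C}^{\mathbf 2}\to\mathcal{C}$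 an $\mathbf{Ord}$-functor, an $\mathbf{Ord}$-comonad $\mathsf{L}=(L,\Phi,\Sigma)$ and an $\mathbf{Ord}$-monad $\mathsf{R}=(R,\Lambda,\Pi)$ on $\mathcal{C}^{\mathbf 2}$ with $L(h,k)=(h,K(h,k))$, $R(h,k)=(K(h,k),k)$, $\Phi_f=(1,Rf)\colon Lf\to f$, $\Lambda_f=(Lf,1)\colon f\to Rf$; then necessarily $\Sigma_f=(1,\sigma_f)$ and $\Pi_f=(\pi_f,1)$, and it is required that $\Delta_f=(\sigma_f,\pi_f)\colon LRf\to RLf$ be a mixed distributive law, i.e. $\Delta\cdot L\Pi=\Pi L\cdot R\Delta\cdot\Delta R$ and $R\Sigma\cdot\Delta=\Delta L\cdot L\Delta\cdot\Sigma R$. A LOFS is an AWFS with $\mathsf{L}$ lax idempotent (equivalently, $\mathsf{R}$ lax idempotent). For a LOFS, (co)algebra structures on a morphism are unique when they exist, so "$f$ is an $\mathsf{L}$-coalgebra" is a property. $\mathsf{L}$-coalgebras are closed under composition. A morphism of AWFSs $(\mathsf{L},\mathsf{R})\to(\mathsf{L}',\mathsf{R}')$ is a natural family $\varphi_f\colon Kf\to K'f$ such that the $(1,\varphi_f)\colon Lf\to L'f$ form a comonad morphism and the $(\varphi_f,1)\colon Rf\to R'f$ form a monad morphism. A LARI is a morphism $f$ having a right adjoint $g$ ($f\cdot g\le 1$) with $g\cdot f=1$; a morphism of LARIs from $f\dashv g$ to $f'\dashv g'$ is a morphism $(h,k)\colon f\to f'$ of $\mathcal{C}^{\mathbf 2}$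 with $g'\cdot k=h\cdot g$. $(\mathsf{E},\mathsf{M})$ denotes the LOFS factoring $f\colon X\to Y$ through the comma-object $f\downarrow 1_Y$, with projections $r_f\colon f\downarrow 1_Y\to X$, $Mf\colon f\downarrow 1_Y\to Y$ ($f\cdot r_f\le Mf$), and $Ef\colon X\to f\downarrow 1_Y$ defined by $Mf\cdot Ef=f$, $r_f\cdot Ef=1$; the comultiplication $(1,\sigma_f)$ is given by $r_{Ef}\cdot\sigma_f=r_f$, $MEf\cdot\sigma_f=1$, and the multiplication $(\pi_f,1)$ by $r_f\cdot\pi_f=r_f\cdot r_{Mf}$, $Mf\cdot\pi_f=M^2f$. Its coalgebras (and their morphisms) are exactly the LARIs (and their morphisms). A LOFS $(\mathsf{L},\mathsf{R})$ is sub-LARI if there exists a morphism of AWFSs $(\mathsf{E},\mathsf{M})\to(\mathsf{L},\mathsf{R})$. A LOFS is cancellative if: (i) whenever $g$ and $g\cdot f$ are $\mathsf{L}$-coalgebras, so is $f$; (ii) whenever $f,g$ and $f',g'$ are composable pairs with $g,g',g\cdot f,g'\cdot f'$ $\mathsf{L}$-coalgebras, and $u,v,w$ satisfy $f'u=vf$, $g'v=wg$, with $(v,w)\colon g\to g'$ and $(u,w)\colon g\cdot f\to g'\cdot f'$ morphisms of $\mathsf{L}$-coalgebras, then $(u,v)\colon f\to f'$ is a morphism of $\mathsf{L}$-coalgebras. For an $\mathbf{Ord}$-monad $\mathsf{T}$ on $\mathcal{C}$, $\mathsf{T}\text{-Emb}$ is the $\mathbf{Ord}$-category whose objects are pairs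 $(f,r)$ with $f\colon X\to Y$ in $\mathcal{C}$ and $r\colon TY\to TX$ a morphism of free $\mathsf{T}$-algebras with $r\cdot Tf=1$, $Tf\cdot r\le1$ (an inequality of morphisms in $\mathsf{T}$-Alg); morphisms $(f,r)\to(g,t)$ are $(h,k)\colon f\to g$ in $\mathcal{C}^{\mathbf 2}$ with $Th\cdot r=t\cdot Tk$, ordered as in $\mathcal{C}^{\mathbf 2}$. $\mathsf{T}$ is fibrantly KZ-generating if the forgetful $\mathbf{Ord}$-functor $\mathsf{T}\text{-Emb}\to\mathcal{C}^{\mathbf 2}$ has an $\mathbf{Ord}$-enriched right adjoint. A LOFS $(\mathsf{L},\mathsf{R})$ is (KZ-)reflective if there is a fibrantly KZ-generating lax idempotent monad $\mathsf{T}$ on $\mathcal{C}$ and an isomorphism $\mathsf{L}\text{-Coalg}\cong\mathsf{T}\text{-Emb}$ commuting with the forgetful functors to $\mathcal{C}^{\mathbf 2}$. *)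

theory Defs
  imports Main
begin

record ('o, 'a) ocat =
  Obj :: "'o set"
  Arr :: "'a set"
  Dom :: "'a \<Rightarrow> 'o"
  Cod :: "'a \<Rightarrow> 'o"
  Ident :: "'o \<Rightarrow> 'a"
  Comp :: "'a \<Rightarrow> 'a \<Rightarrow> 'a" (infixl \<open>\<cdot>\<index>\<close> 70)
  Leq :: "'a \<Rightarrow> 'a \<Rightarrow> bool" (infix \<open>\<sqsubseteq>\<index>\<close> 50)

definition hom :: "('o, 'a) ocat \<Rightarrow> 'o \<Rightarrow> 'o \<Rightarrow> 'a set" where
  "hom C x y = {f \<in> Arr C. Dom C f = x \<and> Cod C f = y}"

text \<open>Composition is written in applicative order. All functions are unconstrained outside
  their intended domain; in particular the relation \<open>\<sqsubseteq>\<close> is meaningful only between parallel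
  arrows.\<close>

locale ord_category =
  fixes C :: "('o, 'a) ocat" (structure)
  assumes Dom_Obj: "f \<in> Arr C \<Longrightarrow> Dom C f \<in> Obj C"
    and Cod_Obj: "f \<in> Arr C \<Longrightarrow> Cod C f \<in> Obj C"
    and Ident_hom: "x \<in> Obj C \<Longrightarrow> Ident C x \<in> hom C x x"
    and Comp_hom: "f \<in> hom C x y \<Longrightarrow> g \<in> hom C y z \<Longrightarrow> g \<cdot> f \<in> hom C x z"
    and Ident_left: "f \<in> hom C x y \<Longrightarrow> Ident C y \<cdot> f = f"
    and Ident_right: "f \<in> hom C x y \<Longrightarrow> f \<cdot> Ident C x = f"
    and Comp_assoc: "f \<in> hom C w x \<Longrightarrow> g \<in> hom C x y \<Longrightarrow> h \<in> hom C y z \<Longrightarrow>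
          (h \<cdot> g) \<cdot> f = h \<cdot> (g \<cdot> f)"
    and Leq_refl: "f \<in> hom C x y \<Longrightarrow> f \<sqsubseteq> f"
    and Leq_antisym: "f \<in> hom C x y \<Longrightarrow> g \<in> hom C x y \<Longrightarrow> f \<sqsubseteq> g \<Longrightarrow> g \<sqsubseteq> f \<Longrightarrow> f = g"
    and Leq_trans: "f \<in> hom C x y \<Longrightarrow> g \<in> hom C x y \<Longrightarrow> h \<in> hom C x y \<Longrightarrow>
          f \<sqsubseteq> g \<Longrightarrow> g \<sqsubseteq> h \<Longrightarrow> f \<sqsubseteq> h"
    and Comp_mono_right: "f \<in> hom C x y \<Longrightarrow> f' \<in> hom C x y \<Longrightarrow> g \<in> hom C y z \<Longrightarrow>
          f \<sqsubseteq> f' \<Longrightarrow> g \<cdot> f \<sqsubseteq> g \<cdot> f'"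
    and Comp_mono_left: "f \<in> hom C x y \<Longrightarrow> g \<in> hom C y z \<Longrightarrow> g' \<in> hom C y z \<Longrightarrow>
          g \<sqsubseteq> g' \<Longrightarrow> g \<cdot> f \<sqsubseteq> g' \<cdot> f"

record ('o, 'a, 'p, 'b) ofun =
  fob :: "'o \<Rightarrow> 'p"
  far :: "'a \<Rightarrow> 'b"

definition ofunctor ::
    "('o, 'a) ocat \<Rightarrow> ('p, 'b) ocat \<Rightarrow> ('o, 'a, 'p, 'b, 'm) ofun_scheme \<Rightarrow> bool" where
  "ofunctor A B F \<longleftrightarrow>
     (\<forall>x\<in>Obj A. fob F x \<in> Obj B) \<and>
     (\<forall>x y. \<forall>f\<in>hom A x y. far F f \<in> hom B (fob F x) (fob F y)) \<and>
     (\<forall>x\<in>Obj A. far F (Ident A x) = Ident B (fob F x)) \<and>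
     (\<forall>x y z. \<forall>f\<in>hom A x y. \<forall>g\<in>hom A y z.
        far F (g \<cdot>\<^bsub>A\<^esub> f) = far F g \<cdot>\<^bsub>B\<^esub> far F f) \<and>
     (\<forall>x y. \<forall>f\<in>hom A x y. \<forall>g\<in>hom A x y. f \<sqsubseteq>\<^bsub>A\<^esub> g \<longrightarrow> far F f \<sqsubseteq>\<^bsub>B\<^esub> far F g)"

definition id_fun :: "('o, 'a, 'o, 'a) ofun" where
  "id_fun = \<lparr>fob = (\<lambda>x. x), far = (\<lambda>f. f)\<rparr>"

definition comp_fun ::
    "('p, 'b, 'q, 'c, 'm) ofun_scheme \<Rightarrow> ('o, 'a, 'p, 'b, 'n) ofun_scheme \<Rightarrow> ('o, 'a, 'q, 'c) ofun"
  where
  "comp_fun G F = \<lparr>fob = (\<lambda>x. fob G (fob F x)), far = (\<lambda>f. far G (far F f))\<rparr>"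

definition nat_trans ::
    "('o, 'a) ocat \<Rightarrow> ('p, 'b) ocat \<Rightarrow> ('o, 'a, 'p, 'b, 'm) ofun_scheme \<Rightarrow>
     ('o, 'a, 'p, 'b, 'n) ofun_scheme \<Rightarrow> ('o \<Rightarrow> 'b) \<Rightarrow> bool" where
  "nat_trans A B F G \<theta> \<longleftrightarrow>
     (\<forall>x\<in>Obj A. \<theta> x \<in> hom B (fob F x) (fob G x)) \<and>
     (\<forall>x y. \<forall>f\<in>hom A x y. far G f \<cdot>\<^bsub>B\<^esub> \<theta> x = \<theta> y \<cdot>\<^bsub>B\<^esub> far F f)"

text \<open>An adjunction in the 2-category of Ord-categories: for Ord-functors the bijections
  \<open>A(a, G b) \<cong> B(U a, b)\<close> induced by unit and counit are automatically isomorphisms of posets.\<close>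

definition has_right_adjoint ::
    "('o, 'a) ocat \<Rightarrow> ('p, 'b) ocat \<Rightarrow> ('o, 'a, 'p, 'b) ofun \<Rightarrow> bool" where
  "has_right_adjoint A B U \<longleftrightarrow>
     (\<exists>(G :: ('p, 'b, 'o, 'a) ofun) \<eta> \<epsilon>.
        ofunctor B A G \<and>
        nat_trans A A id_fun (comp_fun G U) \<eta> \<and>
        nat_trans B B (comp_fun U G) id_fun \<epsilon> \<and>
        (\<forall>x\<in>Obj A. \<epsilon> (fob U x) \<cdot>\<^bsub>B\<^esub> far U (\<eta> x) = Ident B (fob U x)) \<and>
        (\<forall>y\<in>Obj B. far G (\<epsilon> y) \<cdot>\<^bsub>A\<^esub> \<eta> (fob G y) = Ident A (fob G y)))"

text \<open>A weight on \<open>J\<close>, that is, an Ord-functor from \<open>J\<close> to finite posets.\<close>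

record ('o, 'a, 'p) weight =
  wset :: "'o \<Rightarrow> 'p set"
  wle :: "'o \<Rightarrow> 'p \<Rightarrow> 'p \<Rightarrow> bool"
  wmap :: "'a \<Rightarrow> 'p \<Rightarrow> 'p"

definition finite_weight :: "('o, 'a) ocat \<Rightarrow> ('o, 'a, 'p) weight \<Rightarrow> bool" where
  "finite_weight J W \<longleftrightarrow>
     (\<forall>j\<in>Obj J. finite (wset W j) \<and> reflp_on (wset W j) (wle W j) \<and>
        antisymp_on (wset W j) (wle W j) \<and> transp_on (wset W j) (wle W j)) \<and>
     (\<forall>i j. \<forall>m\<in>hom J i j. \<forall>p\<in>wset W i. wmap W m p \<in> wset W j) \<and>
     (\<forall>i j. \<forall>m\<in>hom J i j. \<forall>p\<in>wset W i. \<forall>q\<in>wset W i.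
        wle W i p q \<longrightarrow> wle W j (wmap W m p) (wmap W m q)) \<and>
     (\<forall>j\<in>Obj J. \<forall>p\<in>wset W j. wmap W (Ident J j) p = p) \<and>
     (\<forall>i j k. \<forall>m\<in>hom J i j. \<forall>n\<in>hom J j k. \<forall>p\<in>wset W i.
        wmap W (n \<cdot>\<^bsub>J\<^esub> m) p = wmap W n (wmap W m p)) \<and>
     (\<forall>i j. \<forall>m\<in>hom J i j. \<forall>n\<in>hom J i j. m \<sqsubseteq>\<^bsub>J\<^esub> n \<longrightarrow>
        (\<forall>p\<in>wset W i. wle W j (wmap W m p) (wmap W n p)))"

text \<open>An Ord-natural transformation \<open>W \<Rightarrow> C(x, D -)\<close>.\<close>

definition cylinder ::
    "('j, 'm) ocat \<Rightarrow> ('o, 'a) ocat \<Rightarrow> ('j, 'm, 'p) weight \<Rightarrow> ('j, 'm, 'o, 'a) ofun \<Rightarrow>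
     'o \<Rightarrow> ('j \<Rightarrow> 'p \<Rightarrow> 'a) \<Rightarrow> bool" where
  "cylinder J C W D x c \<longleftrightarrow>
     (\<forall>j\<in>Obj J. \<forall>p\<in>wset W j. c j p \<in> hom C x (fob D j)) \<and>
     (\<forall>j\<in>Obj J. \<forall>p\<in>wset W j. \<forall>q\<in>wset W j. wle W j p q \<longrightarrow> c j p \<sqsubseteq>\<^bsub>C\<^esub> c j q) \<and>
     (\<forall>i j. \<forall>m\<in>hom J i j. \<forall>p\<in>wset W i. far D m \<cdot>\<^bsub>C\<^esub> c i p = c j (wmap W m p))"

text \<open>Composition with \<open>c\<close> is a poset isomorphism from \<open>C(y, x)\<close> to the poset of cylinders
  with vertex \<open>y\<close>: a bijection that reflects the order (it always preserves it).\<close>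

definition weighted_limit ::
    "('j, 'm) ocat \<Rightarrow> ('o, 'a) ocat \<Rightarrow> ('j, 'm, 'p) weight \<Rightarrow> ('j, 'm, 'o, 'a) ofun \<Rightarrow>
     'o \<Rightarrow> ('j \<Rightarrow> 'p \<Rightarrow> 'a) \<Rightarrow> bool" where
  "weighted_limit J C W D x c \<longleftrightarrow>
     x \<in> Obj C \<and> cylinder J C W D x c \<and>
     (\<forall>y\<in>Obj C. \<forall>d. cylinder J C W D y d \<longrightarrow>
        (\<exists>!h. h \<in> hom C y x \<and> (\<forall>j\<in>Obj J. \<forall>p\<in>wset W j. c j p \<cdot>\<^bsub>C\<^esub> h = d j p))) \<and>
     (\<forall>y\<in>Obj C. \<forall>h\<in>hom C y x. \<forall>h'\<in>hom C y x.
        (\<forall>j\<in>Obj J. \<forall>p\<in>wset W j. c j p \<cdot>\<^bsub>C\<^esub> h \<sqsubseteq>\<^bsub>C\<^esub> c j p \<cdot>\<^bsub>C\<^esub> h') \<longrightarrow> h \<sqsubseteq>\<^bsub>C\<^esub> h')"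

text \<open>All finite weighted limits in the sense of Kelly, hence conical finite limits as well as
  comma-objects. Every finite Ord-category and every finite poset has an isomorphic copy
  carried by natural numbers.\<close>

definition finitely_complete :: "('o, 'a) ocat \<Rightarrow> bool" where
  "finitely_complete C \<longleftrightarrow>
     (\<forall>(J :: (nat, nat) ocat) (W :: (nat, nat, nat) weight) (D :: (nat, nat, 'o, 'a) ofun).
        ord_category J \<and> finite (Obj J) \<and> finite (Arr J) \<and> finite_weight J W \<and> ofunctor J C D
        \<longrightarrow> (\<exists>x c. weighted_limit J C W D x c))"

definition is_comma ::
    "('o, 'a) ocat \<Rightarrow> 'a \<Rightarrow> 'a \<Rightarrow> 'o \<Rightarrow> 'a \<Rightarrow> 'a \<Rightarrow> bool" where
  "is_comma C f g x p q \<longleftrightarrow>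
     x \<in> Obj C \<and> p \<in> hom C x (Dom C f) \<and> q \<in> hom C x (Dom C g) \<and>
     f \<cdot>\<^bsub>C\<^esub> p \<sqsubseteq>\<^bsub>C\<^esub> g \<cdot>\<^bsub>C\<^esub> q \<and>
     (\<forall>y\<in>Obj C. \<forall>u\<in>hom C y (Dom C f). \<forall>v\<in>hom C y (Dom C g).
        f \<cdot>\<^bsub>C\<^esub> u \<sqsubseteq>\<^bsub>C\<^esub> g \<cdot>\<^bsub>C\<^esub> v \<longrightarrow>
        (\<exists>!h. h \<in> hom C y x \<and> p \<cdot>\<^bsub>C\<^esub> h = u \<and> q \<cdot>\<^bsub>C\<^esub> h = v)) \<and>
     (\<forall>y\<in>Obj C. \<forall>h\<in>hom C y x. \<forall>h'\<in>hom C y x.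
        p \<cdot>\<^bsub>C\<^esub> h \<sqsubseteq>\<^bsub>C\<^esub> p \<cdot>\<^bsub>C\<^esub> h' \<and> q \<cdot>\<^bsub>C\<^esub> h \<sqsubseteq>\<^bsub>C\<^esub> q \<cdot>\<^bsub>C\<^esub> h' \<longrightarrow> h \<sqsubseteq>\<^bsub>C\<^esub> h')"

text \<open>\<open>Sq f g h k\<close> is the square \<open>(h, k) : f \<rightarrow> g\<close>, with \<open>g h = k f\<close>.\<close>

datatype 'a sq = Sq (src: 'a) (tgt: 'a) (up: 'a) (dn: 'a)

definition arrow_cat :: "('o, 'a) ocat \<Rightarrow> ('a, 'a sq) ocat" where
  "arrow_cat C = \<lparr>
     Obj = Arr C,
     Arr = {Sq f g h k | f g h k. f \<in> Arr C \<and> g \<in> Arr C \<and>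
              h \<in> hom C (Dom C f) (Dom C g) \<and> k \<in> hom C (Cod C f) (Cod C g) \<and>
              g \<cdot>\<^bsub>C\<^esub> h = k \<cdot>\<^bsub>C\<^esub> f},
     Dom = src,
     Cod = tgt,
     Ident = (\<lambda>f. Sq f f (Ident C (Dom C f)) (Ident C (Cod C f))),
     Comp = (\<lambda>t s. Sq (src s) (tgt t) (up t \<cdot>\<^bsub>C\<^esub> up s) (dn t \<cdot>\<^bsub>C\<^esub> dn s)),
     Leq = (\<lambda>s t. up s \<sqsubseteq>\<^bsub>C\<^esub> up t \<and> dn s \<sqsubseteq>\<^bsub>C\<^esub> dn t)\<rparr>"

text \<open>Given structures \<open>S\<close> with underlying objects \<open>U\<close> in \<open>B\<close>, and a predicate \<open>H\<close> selecting the
  underlying arrows that respect the structures, \<open>over_cat B S U H\<close> is the resulting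
  Ord-category, with order inherited from \<open>B\<close>; \<open>forgetful U\<close> is its functor to \<open>B\<close>.\<close>

datatype ('p, 'a) over = Over (osrc: 'p) (otgt: 'p) (und: 'a)

definition over_cat ::
    "('o, 'a) ocat \<Rightarrow> 'p set \<Rightarrow> ('p \<Rightarrow> 'o) \<Rightarrow> ('p \<Rightarrow> 'p \<Rightarrow> 'a \<Rightarrow> bool) \<Rightarrow> ('p, ('p, 'a) over) ocat"
  where
  "over_cat B S U H = \<lparr>
     Obj = S,
     Arr = {Over p q h | p q h. p \<in> S \<and> q \<in> S \<and> h \<in> hom B (U p) (U q) \<and> H p q h},
     Dom = osrc,
     Cod = otgt,
     Ident = (\<lambda>p. Over p p (Ident B (U p))),
     Comp = (\<lambda>k h. Over (osrc h) (otgt k) (und k \<cdot>\<^bsub>B\<^esub> und h)),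
     Leq = (\<lambda>h k. und h \<sqsubseteq>\<^bsub>B\<^esub> und k)\<rparr>"

definition forgetful :: "('p \<Rightarrow> 'o) \<Rightarrow> ('p, ('p, 'a) over, 'o, 'a) ofun" where
  "forgetful U = \<lparr>fob = U, far = und\<rparr>"

definition iso_over ::
    "('p, 'b) ocat \<Rightarrow> ('q, 'c) ocat \<Rightarrow> ('p, 'b, 'o, 'a) ofun \<Rightarrow> ('q, 'c, 'o, 'a) ofun \<Rightarrow> bool" where
  "iso_over P Q U V \<longleftrightarrow>
     (\<exists>(F :: ('p, 'b, 'q, 'c) ofun) (G :: ('q, 'c, 'p, 'b) ofun).
        ofunctor P Q F \<and> ofunctor Q P G \<and>
        (\<forall>x\<in>Obj P. fob G (fob F x) = x) \<and> (\<forall>f\<in>Arr P. far G (far F f) = f) \<and>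
        (\<forall>y\<in>Obj Q. fob F (fob G y) = y) \<and> (\<forall>g\<in>Arr Q. far F (far G g) = g) \<and>
        (\<forall>x\<in>Obj P. fob V (fob F x) = fob U x) \<and> (\<forall>f\<in>Arr P. far V (far F f) = far U f))"

record ('o, 'a) monad = "('o, 'a, 'o, 'a) ofun" +
  munit :: "'o \<Rightarrow> 'a"
  mmult :: "'o \<Rightarrow> 'a"

record ('o, 'a) comonad = "('o, 'a, 'o, 'a) ofun" +
  counit :: "'o \<Rightarrow> 'a"
  comult :: "'o \<Rightarrow> 'a"

definition ord_monad :: "('o, 'a) ocat \<Rightarrow> ('o, 'a) monad \<Rightarrow> bool" where
  "ord_monad C T \<longleftrightarrow>
     ofunctor C C T \<and>
     nat_trans C C id_fun T (munit T) \<and>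
     nat_trans C C (comp_fun T T) T (mmult T) \<and>
     (\<forall>x\<in>Obj C.
        mmult T x \<cdot>\<^bsub>C\<^esub> munit T (fob T x) = Ident C (fob T x) \<and>
        mmult T x \<cdot>\<^bsub>C\<^esub> far T (munit T x) = Ident C (fob T x) \<and>
        mmult T x \<cdot>\<^bsub>C\<^esub> mmult T (fob T x) = mmult T x \<cdot>\<^bsub>C\<^esub> far T (mmult T x))"

definition ord_comonad :: "('o, 'a) ocat \<Rightarrow> ('o, 'a) comonad \<Rightarrow> bool" where
  "ord_comonad C G \<longleftrightarrow>
     ofunctor C C G \<and>
     nat_trans C C G id_fun (counit G) \<and>
     nat_trans C C G (comp_fun G G) (comult G) \<and>
     (\<forall>x\<in>Obj C.
        counit G (fob G x) \<cdot>\<^bsub>C\<^esub> comult G x = Ident C (fob G x) \<and>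
        far G (counit G x) \<cdot>\<^bsub>C\<^esub> comult G x = Ident C (fob G x) \<and>
        comult G (fob G x) \<cdot>\<^bsub>C\<^esub> comult G x = far G (comult G x) \<cdot>\<^bsub>C\<^esub> comult G x)"

definition lax_idempotent_monad :: "('o, 'a) ocat \<Rightarrow> ('o, 'a) monad \<Rightarrow> bool" where
  "lax_idempotent_monad C T \<longleftrightarrow>
     (\<forall>x\<in>Obj C. far T (munit T x) \<sqsubseteq>\<^bsub>C\<^esub> munit T (fob T x))"

definition lax_idempotent_comonad :: "('o, 'a) ocat \<Rightarrow> ('o, 'a) comonad \<Rightarrow> bool" where
  "lax_idempotent_comonad C G \<longleftrightarrow>
     (\<forall>x\<in>Obj C. far G (counit G x) \<sqsubseteq>\<^bsub>C\<^esub> counit G (fob G x))"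

definition monad_morphism ::
    "('o, 'a) ocat \<Rightarrow> ('o, 'a) monad \<Rightarrow> ('o, 'a) monad \<Rightarrow> ('o \<Rightarrow> 'a) \<Rightarrow> bool" where
  "monad_morphism C T T' \<theta> \<longleftrightarrow>
     nat_trans C C T T' \<theta> \<and>
     (\<forall>x\<in>Obj C.
        \<theta> x \<cdot>\<^bsub>C\<^esub> munit T x = munit T' x \<and>
        \<theta> x \<cdot>\<^bsub>C\<^esub> mmult T x = mmult T' x \<cdot>\<^bsub>C\<^esub> (\<theta> (fob T' x) \<cdot>\<^bsub>C\<^esub> far T (\<theta> x)))"

definition comonad_morphism ::
    "('o, 'a) ocat \<Rightarrow> ('o, 'a) comonad \<Rightarrow> ('o, 'a) comonad \<Rightarrow> ('o \<Rightarrow> 'a) \<Rightarrow> bool" where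
  "comonad_morphism C G G' \<theta> \<longleftrightarrow>
     nat_trans C C G G' \<theta> \<and>
     (\<forall>x\<in>Obj C.
        counit G' x \<cdot>\<^bsub>C\<^esub> \<theta> x = counit G x \<and>
        comult G' x \<cdot>\<^bsub>C\<^esub> \<theta> x = (\<theta> (fob G' x) \<cdot>\<^bsub>C\<^esub> far G (\<theta> x)) \<cdot>\<^bsub>C\<^esub> comult G x)"

fun coalgebra :: "('o, 'a) ocat \<Rightarrow> ('o, 'a) comonad \<Rightarrow> 'o \<times> 'a \<Rightarrow> bool" where
  "coalgebra C G (x, a) \<longleftrightarrow>
     x \<in> Obj C \<and> a \<in> hom C x (fob G x) \<and>
     counit G x \<cdot>\<^bsub>C\<^esub> a = Ident C x \<and>
     comult G x \<cdot>\<^bsub>C\<^esub> a = far G a \<cdot>\<^bsub>C\<^esub> a"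

fun coalgebra_hom ::
    "('o, 'a) ocat \<Rightarrow> ('o, 'a) comonad \<Rightarrow> 'o \<times> 'a \<Rightarrow> 'o \<times> 'a \<Rightarrow> 'a \<Rightarrow> bool" where
  "coalgebra_hom C G (x, a) (y, b) h \<longleftrightarrow>
     h \<in> hom C x y \<and> b \<cdot>\<^bsub>C\<^esub> h = far G h \<cdot>\<^bsub>C\<^esub> a"

definition coalg_cat ::
    "('o, 'a) ocat \<Rightarrow> ('o, 'a) comonad \<Rightarrow> ('o \<times> 'a, ('o \<times> 'a, 'a) over) ocat" where
  "coalg_cat C G = over_cat C {p. coalgebra C G p} fst (coalgebra_hom C G)"

fun algebra_hom ::
    "('o, 'a) ocat \<Rightarrow> ('o, 'a) monad \<Rightarrow> 'o \<times> 'a \<Rightarrow> 'o \<times> 'a \<Rightarrow> 'a \<Rightarrow> bool" where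
  "algebra_hom C T (x, a) (y, b) h \<longleftrightarrow>
     h \<in> hom C x y \<and> h \<cdot>\<^bsub>C\<^esub> a = b \<cdot>\<^bsub>C\<^esub> far T h"

definition free_algebra :: "('o, 'a) monad \<Rightarrow> 'o \<Rightarrow> 'o \<times> 'a" where
  "free_algebra T x = (fob T x, mmult T x)"

text \<open>Only the data not determined by the rest are recorded: the functor \<open>K\<close>, the two parts
  \<open>Lf\<close> and \<open>Rf\<close> of the factorisation of \<open>f\<close>, and the families \<open>\<Sigma>\<close>, \<open>\<Pi>\<close> of squares.\<close>

record ('o, 'a) awfs =
  Kfun :: "('a, 'a sq, 'o, 'a) ofun"
  Lpart :: "'a \<Rightarrow> 'a"
  Rpart :: "'a \<Rightarrow> 'a"
  Sig :: "'a \<Rightarrow> 'a sq"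
  Pi :: "'a \<Rightarrow> 'a sq"

definition Lcomonad :: "('o, 'a) ocat \<Rightarrow> ('o, 'a) awfs \<Rightarrow> ('a, 'a sq) comonad" where
  "Lcomonad C A = \<lparr>
     fob = Lpart A,
     far = (\<lambda>s. Sq (Lpart A (src s)) (Lpart A (tgt s)) (up s) (far (Kfun A) s)),
     counit = (\<lambda>f. Sq (Lpart A f) f (Ident C (Dom C f)) (Rpart A f)),
     comult = Sig A\<rparr>"

definition Rmonad :: "('o, 'a) ocat \<Rightarrow> ('o, 'a) awfs \<Rightarrow> ('a, 'a sq) monad" where
  "Rmonad C A = \<lparr>
     fob = Rpart A,
     far = (\<lambda>s. Sq (Rpart A (src s)) (Rpart A (tgt s)) (far (Kfun A) s) (dn s)),
     munit = (\<lambda>f. Sq f (Rpart A f) (Lpart A f) (Ident C (Cod C f))),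
     mmult = Pi A\<rparr>"

text \<open>The comonad and monad laws force \<open>\<Sigma>\<^sub>f = (1, \<sigma>\<^sub>f)\<close> and \<open>\<Pi>\<^sub>f = (\<pi>\<^sub>f, 1)\<close>;
  \<open>awfs_\<Delta>\<close> is \<open>(\<sigma>\<^sub>f, \<pi>\<^sub>f) : LRf \<rightarrow> RLf\<close>. Its naturality and its compatibility with unit and
  counit are automatic, leaving the two equations required in \<open>awfs\<close>.\<close>

definition awfs_\<Delta> :: "('o, 'a) awfs \<Rightarrow> 'a \<Rightarrow> 'a sq" where
  "awfs_\<Delta> A f = Sq (Lpart A (Rpart A f)) (Rpart A (Lpart A f)) (dn (Sig A f)) (up (Pi A f))"

definition awfs :: "('o, 'a) ocat \<Rightarrow> ('o, 'a) awfs \<Rightarrow> bool" where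
  "awfs C A \<longleftrightarrow>
     (let C2 = arrow_cat C; L = Lcomonad C A; R = Rmonad C A; \<Delta> = awfs_\<Delta> A in
     ofunctor C2 C (Kfun A) \<and>
     (\<forall>f\<in>Arr C.
        Lpart A f \<in> hom C (Dom C f) (fob (Kfun A) f) \<and>
        Rpart A f \<in> hom C (fob (Kfun A) f) (Cod C f) \<and>
        Rpart A f \<cdot>\<^bsub>C\<^esub> Lpart A f = f) \<and>
     ord_comonad C2 L \<and>
     ord_monad C2 R \<and>
     (\<forall>f\<in>Arr C.
        \<Delta> f \<cdot>\<^bsub>C2\<^esub> far L (mmult R f) =
          mmult R (fob L f) \<cdot>\<^bsub>C2\<^esub> (far R (\<Delta> f) \<cdot>\<^bsub>C2\<^esub> \<Delta> (fob R f)) \<and>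
        far R (comult L f) \<cdot>\<^bsub>C2\<^esub> \<Delta> f =
          \<Delta> (fob L f) \<cdot>\<^bsub>C2\<^esub> (far L (\<Delta> f) \<cdot>\<^bsub>C2\<^esub> comult L (fob R f))))"

definition lofs :: "('o, 'a) ocat \<Rightarrow> ('o, 'a) awfs \<Rightarrow> bool" where
  "lofs C A \<longleftrightarrow> awfs C A \<and> lax_idempotent_comonad (arrow_cat C) (Lcomonad C A)"

definition awfs_morphism ::
    "('o, 'a) ocat \<Rightarrow> ('o, 'a) awfs \<Rightarrow> ('o, 'a) awfs \<Rightarrow> ('a \<Rightarrow> 'a) \<Rightarrow> bool" where
  "awfs_morphism C A A' \<phi> \<longleftrightarrow>
     nat_trans (arrow_cat C) C (Kfun A) (Kfun A') \<phi> \<and>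
     comonad_morphism (arrow_cat C) (Lcomonad C A) (Lcomonad C A')
       (\<lambda>f. Sq (Lpart A f) (Lpart A' f) (Ident C (Dom C f)) (\<phi> f)) \<and>
     monad_morphism (arrow_cat C) (Rmonad C A) (Rmonad C A')
       (\<lambda>f. Sq (Rpart A f) (Rpart A' f) (\<phi> f) (Ident C (Cod C f)))"

text \<open>\<open>A\<close> is the system \<open>(E, M)\<close> obtained from some choice of comma-objects \<open>f \<down> 1\<close> with first
  projections \<open>r\<^sub>f\<close>; these data determine every component on objects and squares of \<open>C\<close>.\<close>

definition comma_awfs :: "('o, 'a) ocat \<Rightarrow> ('o, 'a) awfs \<Rightarrow> ('a \<Rightarrow> 'a) \<Rightarrow> bool" where
  "comma_awfs C A r \<longleftrightarrow>
     (let K = Kfun A; E = Lpart A; M = Rpart A in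
     (\<forall>f\<in>Arr C.
        is_comma C f (Ident C (Cod C f)) (fob K f) (r f) (M f) \<and>
        E f \<in> hom C (Dom C f) (fob K f) \<and>
        M f \<cdot>\<^bsub>C\<^esub> E f = f \<and> r f \<cdot>\<^bsub>C\<^esub> E f = Ident C (Dom C f)) \<and>
     (\<forall>f g. \<forall>s\<in>hom (arrow_cat C) f g.
        far K s \<in> hom C (fob K f) (fob K g) \<and>
        r g \<cdot>\<^bsub>C\<^esub> far K s = up s \<cdot>\<^bsub>C\<^esub> r f \<and>
        M g \<cdot>\<^bsub>C\<^esub> far K s = dn s \<cdot>\<^bsub>C\<^esub> M f) \<and>
     (\<forall>f\<in>Arr C. \<exists>\<sigma>\<in>hom C (fob K f) (fob K (E f)).
        Sig A f = Sq (E f) (E (E f)) (Ident C (Dom C f)) \<sigma> \<and>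
        r (E f) \<cdot>\<^bsub>C\<^esub> \<sigma> = r f \<and> M (E f) \<cdot>\<^bsub>C\<^esub> \<sigma> = Ident C (fob K f)) \<and>
     (\<forall>f\<in>Arr C. \<exists>\<pi>\<in>hom C (fob K (M f)) (fob K f).
        Pi A f = Sq (M (M f)) (M f) \<pi> (Ident C (Cod C f)) \<and>
        r f \<cdot>\<^bsub>C\<^esub> \<pi> = r f \<cdot>\<^bsub>C\<^esub> r (M f) \<and> M f \<cdot>\<^bsub>C\<^esub> \<pi> = M (M f)))"

definition sub_lari :: "('o, 'a) ocat \<Rightarrow> ('o, 'a) awfs \<Rightarrow> bool" where
  "sub_lari C A \<longleftrightarrow> (\<exists>EM r \<phi>. comma_awfs C EM r \<and> awfs_morphism C EM A \<phi>)"

text \<open>Being a coalgebra, or a morphism of coalgebras, as a property. For a LOFS the structures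
  quantified here are unique.\<close>

definition is_L_coalgebra :: "('o, 'a) ocat \<Rightarrow> ('o, 'a) awfs \<Rightarrow> 'a \<Rightarrow> bool" where
  "is_L_coalgebra C A f \<longleftrightarrow> (\<exists>a. coalgebra (arrow_cat C) (Lcomonad C A) (f, a))"

definition is_L_coalgebra_hom :: "('o, 'a) ocat \<Rightarrow> ('o, 'a) awfs \<Rightarrow> 'a sq \<Rightarrow> bool" where
  "is_L_coalgebra_hom C A s \<longleftrightarrow>
     (\<exists>a b. coalgebra (arrow_cat C) (Lcomonad C A) (src s, a) \<and>
            coalgebra (arrow_cat C) (Lcomonad C A) (tgt s, b) \<and>
            coalgebra_hom (arrow_cat C) (Lcomonad C A) (src s, a) (tgt s, b) s)"

definition cancellative :: "('o, 'a) ocat \<Rightarrow> ('o, 'a) awfs \<Rightarrow> bool" where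
  "cancellative C A \<longleftrightarrow>
     (\<forall>x y z. \<forall>f\<in>hom C x y. \<forall>g\<in>hom C y z.
        is_L_coalgebra C A g \<and> is_L_coalgebra C A (g \<cdot>\<^bsub>C\<^esub> f) \<longrightarrow> is_L_coalgebra C A f) \<and>
     (\<forall>x y z x' y' z'. \<forall>f\<in>hom C x y. \<forall>g\<in>hom C y z. \<forall>f'\<in>hom C x' y'. \<forall>g'\<in>hom C y' z'.
      \<forall>u\<in>hom C x x'. \<forall>v\<in>hom C y y'. \<forall>w\<in>hom C z z'.
        is_L_coalgebra C A g \<and> is_L_coalgebra C A g' \<and>
        is_L_coalgebra C A (g \<cdot>\<^bsub>C\<^esub> f) \<and> is_L_coalgebra C A (g' \<cdot>\<^bsub>C\<^esub> f') \<and>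
        f' \<cdot>\<^bsub>C\<^esub> u = v \<cdot>\<^bsub>C\<^esub> f \<and> g' \<cdot>\<^bsub>C\<^esub> v = w \<cdot>\<^bsub>C\<^esub> g \<and>
        is_L_coalgebra_hom C A (Sq g g' v w) \<and>
        is_L_coalgebra_hom C A (Sq (g \<cdot>\<^bsub>C\<^esub> f) (g' \<cdot>\<^bsub>C\<^esub> f') u w) \<longrightarrow>
        is_L_coalgebra_hom C A (Sq f f' u v))"

definition emb_objects :: "('o, 'a) ocat \<Rightarrow> ('o, 'a) monad \<Rightarrow> ('a \<times> 'a) set" where
  "emb_objects C T = {(f, r).
     f \<in> Arr C \<and>
     algebra_hom C T (free_algebra T (Cod C f)) (free_algebra T (Dom C f)) r \<and>
     r \<cdot>\<^bsub>C\<^esub> far T f = Ident C (fob T (Dom C f)) \<and>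
     far T f \<cdot>\<^bsub>C\<^esub> r \<sqsubseteq>\<^bsub>C\<^esub> Ident C (fob T (Cod C f))}"

definition emb_cat ::
    "('o, 'a) ocat \<Rightarrow> ('o, 'a) monad \<Rightarrow> ('a \<times> 'a, ('a \<times> 'a, 'a sq) over) ocat" where
  "emb_cat C T = over_cat (arrow_cat C) (emb_objects C T) fst
     (\<lambda>(f, r) (g, t) s. far T (up s) \<cdot>\<^bsub>C\<^esub> r = t \<cdot>\<^bsub>C\<^esub> far T (dn s))"

definition fibrantly_KZ_generating :: "('o, 'a) ocat \<Rightarrow> ('o, 'a) monad \<Rightarrow> bool" where
  "fibrantly_KZ_generating C T \<longleftrightarrow>
     has_right_adjoint (emb_cat C T) (arrow_cat C) (forgetful fst)"

definition kz_reflective :: "('o, 'a) ocat \<Rightarrow> ('o, 'a) awfs \<Rightarrow> bool" where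
  "kz_reflective C A \<longleftrightarrow>
     (\<exists>T. ord_monad C T \<and> lax_idempotent_monad C T \<and> fibrantly_KZ_generating C T \<and>
        iso_over (coalg_cat (arrow_cat C) (Lcomonad C A)) (emb_cat C T)
          (forgetful fst) (forgetful fst))"

end

(* If (L, R) is cancellative, let T be the restriction of R to the fibre over the terminal object,
   so that the units X -> TX are the cofree L-coalgebras L(X -> 1). An L-coalgebra f : X -> Y with
   structure s yields Y -> Kf -> TX, whose transpose TY -> TX exhibits f as a T-embedding.
   Conversely, if f is a T-embedding then Tf is a LARI, hence an L-coalgebra since the system is
   sub-LARI; so eta_Y f = Tf eta_X is an L-coalgebra, and cancellation of eta_Y makes f one.
   The same argument applies to morphisms, and fibrant KZ-generation is the existence of cofree
   L-coalgebras. The other implication holds because T-embeddings always cancel.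

   Lax idempotency of R makes every s with s f = Lf and Rf s = 1 a coalgebra structure on f. This
   gives closure of coalgebras under composition and the coalgebra structure of LARIs without the
   distributive law. *)

theory Submission
  imports Defs
begin

text \<open>Both kinds of structure are right adjoints. A coalgebra structure \<open>s\<close> on
  \<open>f\<close> is right adjoint to \<open>Rf\<close> with \<open>Rf s = 1\<close>, and an
  embedding structure \<open>r\<close> is right adjoint to \<open>Tf\<close> with
  \<open>r Tf = 1\<close>. Hom-posets are antisymmetric, so each structure is equal to any other on
  the same arrow, not merely isomorphic to it. The isomorphism of categories therefore splits into
  two equivalences, one about arrows and one about squares, and a structure obtained from a bare
  existence statement can always be identified with a given one. The first part of cancellativity
  settles the arrows and the second part the squares. The inequality \<open>Tf r \<le> 1\<close> is
  the point where the order on a coalgebra has to be compared with the unit of \<open>T\<close>. It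
  comes from the identity of \<open>Y\<close>, regarded as a coalgebra, whose structure is the
  greatest section of \<open>R(1)\<close>.\<close>

section \<open>Ord-categories, right adjoints and the arrow category\<close>

context ord_category
begin

lemma hom_iff: "f \<in> hom C x y \<longleftrightarrow> f \<in> Arr C \<and> Dom C f = x \<and> Cod C f = y"
  by (auto simp: hom_def)

lemma arr_comp [simp]:
  assumes "f \<in> Arr C" "g \<in> Arr C" "Cod C f = Dom C g"
  shows "g \<cdot> f \<in> Arr C" "Dom C (g \<cdot> f) = Dom C f" "Cod C (g \<cdot> f) = Cod C g"
  using Comp_hom[of f "Dom C f" "Dom C g" g "Cod C g"] assms by (auto simp: hom_iff)

lemma arr_ident [simp]:
  assumes "x \<in> Obj C"
  shows "Ident C x \<in> Arr C" "Dom C (Ident C x) = x" "Cod C (Ident C x) = x"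
  using Ident_hom[OF assms] by (auto simp: hom_iff)

declare Dom_Obj [simp] Cod_Obj [simp]

lemma comp_ident [simp]:
  assumes "f \<in> Arr C"
  shows "Cod C f = x \<Longrightarrow> Ident C x \<cdot> f = f" "Dom C f = x \<Longrightarrow> f \<cdot> Ident C x = f"
  using Ident_left[of f] Ident_right[of f] assms by (auto simp: hom_iff)

lemma comp_assoc:
  assumes "f \<in> Arr C" "g \<in> Arr C" "h \<in> Arr C" "Cod C f = Dom C g" "Cod C g = Dom C h"
  shows "(h \<cdot> g) \<cdot> f = h \<cdot> (g \<cdot> f)"
  using Comp_assoc[of f "Dom C f" "Dom C g" g "Dom C h" h "Cod C h"] assms
  by (auto simp: hom_iff)

lemma comp_extend:
  assumes "h \<cdot> g = h' \<cdot> g'"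
    and "f \<in> Arr C" "g \<in> Arr C" "h \<in> Arr C" "Cod C f = Dom C g" "Cod C g = Dom C h"
    and "g' \<in> Arr C" "h' \<in> Arr C" "Cod C f = Dom C g'" "Cod C g' = Dom C h'"
  shows "h \<cdot> (g \<cdot> f) = h' \<cdot> (g' \<cdot> f)"
  using assms comp_assoc by metis

lemma leq_refl [simp]: "f \<in> Arr C \<Longrightarrow> f \<sqsubseteq> f"
  using Leq_refl by (auto simp: hom_iff)

lemma leq_trans:
  assumes "f \<sqsubseteq> g" "g \<sqsubseteq> h" "f \<in> hom C x y" "g \<in> hom C x y" "h \<in> hom C x y"
  shows "f \<sqsubseteq> h"
  using Leq_trans assms by blast

lemma comp_mono:
  assumes "f \<sqsubseteq> f'" "g \<sqsubseteq> g'" "f \<in> hom C x y" "f' \<in> hom C x y" "g \<in> hom C y z" "g' \<in> hom C y z"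
  shows "g \<cdot> f \<sqsubseteq> g' \<cdot> f'"
  using Leq_trans[of "g \<cdot> f" x z "g \<cdot> f'" "g' \<cdot> f'"] Comp_mono_right[of f x y f' g z]
    Comp_mono_left[of f' x y g z g'] Comp_hom assms by blast

text \<open>\<open>g = 1 g \<le> g' f g \<le> g'\<close>. Only the counit of \<open>g\<close> and
  the unit of \<open>g'\<close> enter, so two such comparisons give the uniqueness on which every
  uniqueness statement about structures rests.\<close>

lemma right_adjoint_le:
  assumes "f \<in> hom C x y" "g \<in> hom C y x" "g' \<in> hom C y x"
    and "f \<cdot> g \<sqsubseteq> Ident C y" "Ident C x \<sqsubseteq> g' \<cdot> f"
  shows "g \<sqsubseteq> g'"
proof -
  have "Ident C x \<cdot> g \<sqsubseteq> (g' \<cdot> f) \<cdot> g"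
    using assms by (intro comp_mono[of _ _ _ _ y x x]) (auto simp: hom_iff)
  moreover have "g' \<cdot> (f \<cdot> g) \<sqsubseteq> g' \<cdot> Ident C y"
    using assms by (intro comp_mono[of _ _ _ _ y y x]) (auto simp: hom_iff)
  ultimately show ?thesis
    using assms leq_trans[of g "g' \<cdot> (f \<cdot> g)" g' y x] by (auto simp: hom_iff comp_assoc)
qed

lemma right_adjoint_unique:
  assumes "f \<in> hom C x y" "g \<in> hom C y x" "g' \<in> hom C y x"
    and "f \<cdot> g \<sqsubseteq> Ident C y" "Ident C x \<sqsubseteq> g \<cdot> f"
    and "f \<cdot> g' \<sqsubseteq> Ident C y" "Ident C x \<sqsubseteq> g' \<cdot> f"
  shows "g = g'"
  using right_adjoint_le[of f x y g g'] right_adjoint_le[of f x y g' g] Leq_antisym assms by blast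

text \<open>The arrows of \<open>arrow_cat C\<close>, with typing given as equations on
  \<open>Dom\<close> and \<open>Cod\<close>: this is the form in which the side conditions of
  associativity are discharged.\<close>

definition square :: "'a \<Rightarrow> 'a \<Rightarrow> 'a \<Rightarrow> 'a \<Rightarrow> bool" where
  "square f g h k \<longleftrightarrow> f \<in> Arr C \<and> g \<in> Arr C \<and> h \<in> Arr C \<and> Dom C h = Dom C f \<and> Cod C h = Dom C g \<and>
     k \<in> Arr C \<and> Dom C k = Cod C f \<and> Cod C k = Cod C g \<and> g \<cdot> h = k \<cdot> f"

lemma square_paste:
  assumes "square f g h k" "square g e h' k'"
  shows "square f e (h' \<cdot> h) (k' \<cdot> k)"
proof -
  have "e \<cdot> (h' \<cdot> h) = k' \<cdot> (g \<cdot> h)"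
    by (rule comp_extend) (use assms in \<open>auto simp: square_def\<close>)
  then show ?thesis
    using assms by (simp add: square_def comp_assoc)
qed

lemma Sq_Arr [simp]: "Sq f g h k \<in> Arr (arrow_cat C) \<longleftrightarrow> square f g h k"
  by (auto simp: arrow_cat_def square_def hom_iff)

lemma Arr_arrow_cat: "s \<in> Arr (arrow_cat C) \<longleftrightarrow> square (src s) (tgt s) (up s) (dn s)"
  by (cases s) auto

lemma arrow_cat_simps [simp]:
  "Obj (arrow_cat C) = Arr C"
  "Dom (arrow_cat C) = src"
  "Cod (arrow_cat C) = tgt"
  "Ident (arrow_cat C) f = Sq f f (Ident C (Dom C f)) (Ident C (Cod C f))"
  "t \<cdot>\<^bsub>arrow_cat C\<^esub> s = Sq (src s) (tgt t) (up t \<cdot> up s) (dn t \<cdot> dn s)"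
  "s \<sqsubseteq>\<^bsub>arrow_cat C\<^esub> t \<longleftrightarrow> up s \<sqsubseteq> up t \<and> dn s \<sqsubseteq> dn t"
  by (auto simp: arrow_cat_def)

lemma hom_arrow_cat: "s \<in> hom (arrow_cat C) f g \<longleftrightarrow> (\<exists>h k. s = Sq f g h k \<and> square f g h k)"
  by (cases s) (auto simp: hom_def)

lemma ord_category_arrow_cat: "ord_category (arrow_cat C)"
proof
  fix s s' t f g e
  assume "s \<in> hom (arrow_cat C) f g" "s' \<in> hom (arrow_cat C) f g" "t \<in> hom (arrow_cat C) g e"
    and "s \<sqsubseteq>\<^bsub>arrow_cat C\<^esub> s'"
  then show "t \<cdot>\<^bsub>arrow_cat C\<^esub> s \<sqsubseteq>\<^bsub>arrow_cat C\<^esub> t \<cdot>\<^bsub>arrow_cat C\<^esub> s'"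
    by (fastforce simp: hom_arrow_cat square_def hom_iff
        intro: comp_mono[of _ _ _ _ "Dom C f" "Dom C g" "Dom C e"]
          comp_mono[of _ _ _ _ "Cod C f" "Cod C g" "Cod C e"])
next
  fix s t t' f g e
  assume "s \<in> hom (arrow_cat C) f g" "t \<in> hom (arrow_cat C) g e" "t' \<in> hom (arrow_cat C) g e"
    and "t \<sqsubseteq>\<^bsub>arrow_cat C\<^esub> t'"
  then show "t \<cdot>\<^bsub>arrow_cat C\<^esub> s \<sqsubseteq>\<^bsub>arrow_cat C\<^esub> t' \<cdot>\<^bsub>arrow_cat C\<^esub> s"
    by (fastforce simp: hom_arrow_cat square_def hom_iff
        intro: comp_mono[of _ _ _ _ "Dom C f" "Dom C g" "Dom C e"]
          comp_mono[of _ _ _ _ "Cod C f" "Cod C g" "Cod C e"])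
next
  fix s t u f g
  assume "s \<in> hom (arrow_cat C) f g" "t \<in> hom (arrow_cat C) f g" "u \<in> hom (arrow_cat C) f g"
    and "s \<sqsubseteq>\<^bsub>arrow_cat C\<^esub> t" "t \<sqsubseteq>\<^bsub>arrow_cat C\<^esub> u"
  then show "s \<sqsubseteq>\<^bsub>arrow_cat C\<^esub> u"
    by (fastforce simp: hom_arrow_cat square_def hom_iff
        intro: leq_trans[of _ _ _ "Dom C f" "Dom C g"] leq_trans[of _ _ _ "Cod C f" "Cod C g"])
next
  fix s t f g
  assume "s \<in> hom (arrow_cat C) f g" "t \<in> hom (arrow_cat C) f g"
    and "s \<sqsubseteq>\<^bsub>arrow_cat C\<^esub> t" "t \<sqsubseteq>\<^bsub>arrow_cat C\<^esub> s"
  then show "s = t"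
    by (auto simp: hom_arrow_cat square_def hom_iff
        intro: Leq_antisym[of _ "Dom C f" "Dom C g"] Leq_antisym[of _ "Cod C f" "Cod C g"])
qed (auto simp: Arr_arrow_cat hom_arrow_cat comp_assoc intro: square_paste, auto simp: square_def comp_assoc)

end

section \<open>The terminal object; elementary facts on functors and transformations\<close>

text \<open>A terminal object is the limit of the empty diagram: over an empty \<open>J\<close>
  every family is a cylinder, so unique factorisation leaves exactly one arrow from each
  object.\<close>

lemma finitely_complete_terminal:
  assumes "finitely_complete C"
  obtains t where "t \<in> Obj C" "\<And>y. y \<in> Obj C \<Longrightarrow> \<exists>!h. h \<in> hom C y t"
proof -
  define J :: "(nat, nat) ocat" where
    "J = \<lparr>Obj = {}, Arr = {}, Dom = undefined, Cod = undefined, Ident = undefined,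
       Comp = undefined, Leq = undefined\<rparr>"
  have "ord_category J"
    by standard (auto simp: J_def hom_def)
  \<comment> \<open>All conditions on a weight and a diagram range over the empty \<open>J\<close>,
    so arbitrary values satisfy them, in particular \<open>undefined\<close>.\<close>
  moreover have "finite_weight J W" "ofunctor J C D" for W :: "(nat, nat, nat) weight" and D
    by (auto simp: finite_weight_def ofunctor_def J_def hom_def)
  ultimately obtain x c where
    "weighted_limit J C (undefined :: (nat, nat, nat) weight) undefined x c"
    using assms unfolding finitely_complete_def
    by (metis J_def finite.emptyI ocat.select_convs(1,2))
  then have "x \<in> Obj C" "\<And>y. y \<in> Obj C \<Longrightarrow> \<exists>!h. h \<in> hom C y x"
    by (auto simp: weighted_limit_def cylinder_def J_def hom_def)
  then show thesis
    using that by blast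
qed

lemma ofunctor_ob: "ofunctor A B F \<Longrightarrow> x \<in> Obj A \<Longrightarrow> fob F x \<in> Obj B"
  by (simp add: ofunctor_def)

lemma ofunctor_hom:
  "ofunctor A B F \<Longrightarrow> f \<in> hom A x y \<Longrightarrow> far F f \<in> hom B (fob F x) (fob F y)"
  by (simp add: ofunctor_def)

lemma ofunctor_ident:
  "ofunctor A B F \<Longrightarrow> x \<in> Obj A \<Longrightarrow> far F (Ident A x) = Ident B (fob F x)"
  by (simp add: ofunctor_def)

lemma ofunctor_comp:
  "ofunctor A B F \<Longrightarrow> f \<in> hom A x y \<Longrightarrow> g \<in> hom A y z \<Longrightarrow>
    far F (g \<cdot>\<^bsub>A\<^esub> f) = far F g \<cdot>\<^bsub>B\<^esub> far F f"
  unfolding ofunctor_def by blast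

lemma ofunctor_mono:
  "ofunctor A B F \<Longrightarrow> f \<in> hom A x y \<Longrightarrow> g \<in> hom A x y \<Longrightarrow> f \<sqsubseteq>\<^bsub>A\<^esub> g \<Longrightarrow>
    far F f \<sqsubseteq>\<^bsub>B\<^esub> far F g"
  unfolding ofunctor_def by blast

lemma nat_trans_hom:
  "nat_trans A B F G \<theta> \<Longrightarrow> x \<in> Obj A \<Longrightarrow> \<theta> x \<in> hom B (fob F x) (fob G x)"
  by (simp add: nat_trans_def)

lemma nat_trans_eq:
  "nat_trans A B F G \<theta> \<Longrightarrow> f \<in> hom A x y \<Longrightarrow> far G f \<cdot>\<^bsub>B\<^esub> \<theta> x = \<theta> y \<cdot>\<^bsub>B\<^esub> far F f"
  unfolding nat_trans_def by blast

section \<open>Lax orthogonal factorisation systems\<close>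

locale lax_orthogonal = ord_category C
  for C :: "('o, 'a) ocat" (structure) +
  fixes A :: "('o, 'a) awfs"
  assumes lofs: "lofs C A"
begin

abbreviation K where "K \<equiv> fob (Kfun A)"
abbreviation Kmap where "Kmap f g h k \<equiv> far (Kfun A) (Sq f g h k)"
abbreviation L where "L \<equiv> Lpart A"
abbreviation R where "R \<equiv> Rpart A"
abbreviation \<sigma> where "\<sigma> f \<equiv> dn (Sig A f)"
abbreviation \<pi> where "\<pi> f \<equiv> up (Pi A f)"

lemma awfs: "awfs C A"
  using lofs by (simp add: lofs_def)

lemma K_functor: "ofunctor (arrow_cat C) C (Kfun A)"
  using awfs by (simp add: awfs_def Let_def)

lemma L_comonad: "ord_comonad (arrow_cat C) (Lcomonad C A)"
  using awfs by (simp add: awfs_def Let_def)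

lemma R_monad: "ord_monad (arrow_cat C) (Rmonad C A)"
  using awfs by (simp add: awfs_def Let_def)

lemma factorisation [simp]:
  assumes "f \<in> Arr C"
  shows "K f \<in> Obj C" "L f \<in> Arr C" "Dom C (L f) = Dom C f" "Cod C (L f) = K f"
    "R f \<in> Arr C" "Dom C (R f) = K f" "Cod C (R f) = Cod C f" "R f \<cdot> L f = f"
  using awfs assms K_functor by (auto simp: awfs_def Let_def hom_iff ofunctor_def)

lemma Kmap_arr:
  assumes "square f g h k"
  shows "Kmap f g h k \<in> Arr C" "Dom C (Kmap f g h k) = K f" "Cod C (Kmap f g h k) = K g"
  using ofunctor_hom[OF K_functor, of "Sq f g h k" f g] assms by (auto simp: hom_arrow_cat hom_iff)

lemma Kmap_ident [simp]:
  "f \<in> Arr C \<Longrightarrow> Dom C f = x \<Longrightarrow> Cod C f = y \<Longrightarrow>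
    Kmap f f (Ident C x) (Ident C y) = Ident C (K f)"
  using ofunctor_ident[OF K_functor, of f] by auto

lemma Kmap_comp:
  assumes "square f g h k" "square g e h' k'"
  shows "Kmap g e h' k' \<cdot> Kmap f g h k = Kmap f e (h' \<cdot> h) (k' \<cdot> k)"
  using ofunctor_comp[OF K_functor, of "Sq f g h k" f g "Sq g e h' k'" e] assms
  by (simp add: hom_arrow_cat)

lemma Kmap_mono:
  assumes "square f g h k" "square f g h' k'" "h \<sqsubseteq> h'" "k \<sqsubseteq> k'"
  shows "Kmap f g h k \<sqsubseteq> Kmap f g h' k'"
  using ofunctor_mono[OF K_functor, of "Sq f g h k" f g "Sq f g h' k'"] assms
  by (simp add: hom_arrow_cat)

lemma L_functor: "ofunctor (arrow_cat C) (arrow_cat C) (Lcomonad C A)"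
  using L_comonad by (simp add: ord_comonad_def)

lemma R_functor: "ofunctor (arrow_cat C) (arrow_cat C) (Rmonad C A)"
  using R_monad by (simp add: ord_monad_def)

lemma L_square:
  assumes "square f g h k"
  shows "square (L f) (L g) h (Kmap f g h k)"
  using ofunctor_hom[OF L_functor, of "Sq f g h k" f g] assms
  by (simp add: hom_arrow_cat Lcomonad_def)

lemma R_square:
  assumes "square f g h k"
  shows "square (R f) (R g) (Kmap f g h k) k"
  using ofunctor_hom[OF R_functor, of "Sq f g h k" f g] assms
  by (simp add: hom_arrow_cat Rmonad_def)

lemma Kmap_L: "square f g h k \<Longrightarrow> Kmap f g h k \<cdot> L f = L g \<cdot> h"
  using L_square[of f g h k] unfolding square_def by (elim conjE, metis)

lemma Kmap_R: "square f g h k \<Longrightarrow> R g \<cdot> Kmap f g h k = k \<cdot> R f"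
  using R_square[of f g h k] unfolding square_def by (elim conjE, metis)

lemma counit_square: "f \<in> Arr C \<Longrightarrow> square (L f) f (Ident C (Dom C f)) (R f)"
  by (simp add: square_def)

lemma unit_square: "f \<in> Arr C \<Longrightarrow> square f (R f) (L f) (Ident C (Cod C f))"
  by (simp add: square_def)

lemma square_ident [simp]: "f \<in> Arr C \<Longrightarrow> square f f (Ident C (Dom C f)) (Ident C (Cod C f))"
  by (simp add: square_def)

lemma L_lax:
  "f \<in> Arr C \<Longrightarrow> Kmap (L f) f (Ident C (Dom C f)) (R f) \<sqsubseteq> R (L f)"
  using lofs by (auto simp: lofs_def lax_idempotent_comonad_def Lcomonad_def)

text \<open>The counit has an identity as its upper component, so the first counit law forces the
  upper component of \<open>Sig A f\<close> to be an identity as well.\<close>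

lemma Sig_square:
  assumes "f \<in> Arr C"
  shows "Sig A f = Sq (L f) (L (L f)) (Ident C (Dom C f)) (\<sigma> f)"
    and "square (L f) (L (L f)) (Ident C (Dom C f)) (\<sigma> f)"
proof -
  have "nat_trans (arrow_cat C) (arrow_cat C) (Lcomonad C A)
      (comp_fun (Lcomonad C A) (Lcomonad C A)) (Sig A)"
    using L_comonad by (simp add: ord_comonad_def Lcomonad_def)
  from nat_trans_hom[OF this, of f] assms
  obtain h k where S: "Sig A f = Sq (L f) (L (L f)) h k" "square (L f) (L (L f)) h k"
    by (auto simp: Lcomonad_def hom_arrow_cat comp_fun_def)
  have "counit (Lcomonad C A) (fob (Lcomonad C A) f) \<cdot>\<^bsub>arrow_cat C\<^esub> comult (Lcomonad C A) f =
      Ident (arrow_cat C) (fob (Lcomonad C A) f)"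
    using L_comonad assms unfolding ord_comonad_def by simp
  then have "Ident C (Dom C f) \<cdot> h = Ident C (Dom C f)"
    using S assms by (simp add: Lcomonad_def)
  then have "h = Ident C (Dom C f)"
    using S assms by (simp add: square_def)
  then show "Sig A f = Sq (L f) (L (L f)) (Ident C (Dom C f)) (\<sigma> f)"
    and "square (L f) (L (L f)) (Ident C (Dom C f)) (\<sigma> f)"
    using S by auto
qed

lemma \<sigma>_laws:
  assumes "f \<in> Arr C"
  shows "\<sigma> f \<in> Arr C" "Dom C (\<sigma> f) = K f" "Cod C (\<sigma> f) = K (L f)"
    "\<sigma> f \<cdot> L f = L (L f)" "R (L f) \<cdot> \<sigma> f = Ident C (K f)"
    "Kmap (L f) f (Ident C (Dom C f)) (R f) \<cdot> \<sigma> f = Ident C (K f)"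
proof -
  show "\<sigma> f \<in> Arr C" "Dom C (\<sigma> f) = K f" "Cod C (\<sigma> f) = K (L f)" "\<sigma> f \<cdot> L f = L (L f)"
    using Sig_square(2)[OF assms] assms by (simp_all add: square_def)
  show "R (L f) \<cdot> \<sigma> f = Ident C (K f)"
    "Kmap (L f) f (Ident C (Dom C f)) (R f) \<cdot> \<sigma> f = Ident C (K f)"
    using L_comonad assms unfolding ord_comonad_def by (simp_all add: Lcomonad_def)
qed

text \<open>Dual to \<open>Sig_square\<close>: the unit has an identity as its lower component, and
  a unit law passes this on to the multiplication.\<close>

lemma Pi_square:
  assumes "f \<in> Arr C"
  shows "Pi A f = Sq (R (R f)) (R f) (\<pi> f) (Ident C (Cod C f))"
    and "square (R (R f)) (R f) (\<pi> f) (Ident C (Cod C f))"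
proof -
  have "nat_trans (arrow_cat C) (arrow_cat C) (comp_fun (Rmonad C A) (Rmonad C A))
      (Rmonad C A) (Pi A)"
    using R_monad by (simp add: ord_monad_def Rmonad_def)
  from nat_trans_hom[OF this, of f] assms
  obtain h k where S: "Pi A f = Sq (R (R f)) (R f) h k" "square (R (R f)) (R f) h k"
    by (auto simp: Rmonad_def hom_arrow_cat comp_fun_def)
  have "mmult (Rmonad C A) f \<cdot>\<^bsub>arrow_cat C\<^esub> munit (Rmonad C A) (fob (Rmonad C A) f) =
      Ident (arrow_cat C) (fob (Rmonad C A) f)"
    using R_monad assms unfolding ord_monad_def by simp
  then have "k \<cdot> Ident C (Cod C f) = Ident C (Cod C f)"
    using S assms by (simp add: Rmonad_def)
  then have "k = Ident C (Cod C f)"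
    using S assms by (simp add: square_def)
  then show "Pi A f = Sq (R (R f)) (R f) (\<pi> f) (Ident C (Cod C f))"
    and "square (R (R f)) (R f) (\<pi> f) (Ident C (Cod C f))"
    using S by auto
qed

lemma \<pi>_laws:
  assumes "f \<in> Arr C"
  shows "\<pi> f \<in> Arr C" "Dom C (\<pi> f) = K (R f)" "Cod C (\<pi> f) = K f"
    "R f \<cdot> \<pi> f = R (R f)" "\<pi> f \<cdot> L (R f) = Ident C (K f)"
    "\<pi> f \<cdot> Kmap f (R f) (L f) (Ident C (Cod C f)) = Ident C (K f)"
    "\<pi> f \<cdot> \<pi> (R f) = \<pi> f \<cdot> Kmap (R (R f)) (R f) (\<pi> f) (Ident C (Cod C f))"
proof -
  show "\<pi> f \<in> Arr C" "Dom C (\<pi> f) = K (R f)" "Cod C (\<pi> f) = K f" "R f \<cdot> \<pi> f = R (R f)"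
    using Pi_square(2)[OF assms] assms by (simp_all add: square_def)
  show "\<pi> f \<cdot> L (R f) = Ident C (K f)"
    "\<pi> f \<cdot> Kmap f (R f) (L f) (Ident C (Cod C f)) = Ident C (K f)"
    using R_monad assms unfolding ord_monad_def by (simp_all add: Rmonad_def)
  have "mmult (Rmonad C A) f \<cdot>\<^bsub>arrow_cat C\<^esub> mmult (Rmonad C A) (R f) =
    mmult (Rmonad C A) f \<cdot>\<^bsub>arrow_cat C\<^esub> far (Rmonad C A) (mmult (Rmonad C A) f)"
    using R_monad assms unfolding ord_monad_def by (simp add: Rmonad_def)
  then show "\<pi> f \<cdot> \<pi> (R f) = \<pi> f \<cdot> Kmap (R (R f)) (R f) (\<pi> f) (Ident C (Cod C f))"
    using assms Pi_square(1)[OF assms] by (simp add: Rmonad_def)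
qed

lemma \<pi>_natural:
  assumes "square f g h k"
  shows "Kmap f g h k \<cdot> \<pi> f = \<pi> g \<cdot> Kmap (R f) (R g) (Kmap f g h k) k"
proof -
  have "nat_trans (arrow_cat C) (arrow_cat C) (comp_fun (Rmonad C A) (Rmonad C A))
      (Rmonad C A) (Pi A)"
    using R_monad by (simp add: ord_monad_def Rmonad_def)
  from nat_trans_eq[OF this, of "Sq f g h k" f g] assms show ?thesis
    by (simp add: hom_arrow_cat Rmonad_def comp_fun_def)
qed

section \<open>Lax idempotency, and coalgebra structures as right adjoints\<close>

text \<open>By the counit laws, every \<open>k : Gx \<rightarrow> Gy\<close> satisfies \<open>G(\<epsilon> \<cdot> k) \<cdot> \<delta> \<le> k\<close> for a lax idempotent
  comonad \<open>G\<close>. For \<open>k = (Lf, L(Rf)) : Lf \<rightarrow> LRf\<close> this is lax idempotency of the monad \<open>R\<close>.\<close>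

lemma R_lax:
  assumes f: "f \<in> Arr C"
  shows "Kmap f (R f) (L f) (Ident C (Cod C f)) \<sqsubseteq> L (R f)"
proof -
  let ?x = "Dom C f" and ?y = "Cod C f"
  have sq: "square (L f) (L (R f)) (L f) (L (R f))"
    using f by (simp add: square_def)
  note a = Kmap_arr[OF sq] Kmap_arr[OF counit_square[OF f]] Kmap_arr[OF unit_square[OF f]]
    Kmap_arr[OF counit_square, of "R f"] \<sigma>_laws(1-3)[OF f]
  have "Kmap f (R f) (L f) (Ident C ?y) =
      Kmap f (R f) (L f) (Ident C ?y) \<cdot> (Kmap (L f) f (Ident C ?x) (R f) \<cdot> \<sigma> f)"
    using a f by (simp add: \<sigma>_laws)
  also have "\<dots> = (Kmap f (R f) (L f) (Ident C ?y) \<cdot> Kmap (L f) f (Ident C ?x) (R f)) \<cdot> \<sigma> f"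
    using a f by (simp add: comp_assoc)
  also have "Kmap f (R f) (L f) (Ident C ?y) \<cdot> Kmap (L f) f (Ident C ?x) (R f) =
      Kmap (L f) (R f) (L f) (R f)"
    using f by (simp add: Kmap_comp counit_square unit_square)
  \<comment> \<open>The square \<open>(Lf, Rf)\<close> from \<open>Lf\<close> to \<open>Rf\<close>
    factors through \<open>f\<close> and also through \<open>LRf\<close>. Passing from the first
    factorisation to the second brings in \<open>K(1, RRf)\<close>, which \<open>L_lax\<close>
    bounds by \<open>R(LRf)\<close>.\<close>
  also have "\<dots> = Kmap (L (R f)) (R f) (Ident C (K f)) (R (R f)) \<cdot>
      Kmap (L f) (L (R f)) (L f) (L (R f))"
    using f sq Kmap_comp[OF sq counit_square[of "R f"]] by simp
  finally have eq: "Kmap f (R f) (L f) (Ident C ?y) =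
    (Kmap (L (R f)) (R f) (Ident C (K f)) (R (R f)) \<cdot> Kmap (L f) (L (R f)) (L f) (L (R f))) \<cdot> \<sigma> f" .
  have "(R (L (R f)) \<cdot> Kmap (L f) (L (R f)) (L f) (L (R f))) \<cdot> \<sigma> f = (L (R f) \<cdot> R (L f)) \<cdot> \<sigma> f"
    by (simp only: Kmap_R[OF sq])
  also have "\<dots> = L (R f)"
    using a f by (simp add: comp_assoc \<sigma>_laws)
  finally have eq': "(R (L (R f)) \<cdot> Kmap (L f) (L (R f)) (L f) (L (R f))) \<cdot> \<sigma> f = L (R f)" .
  have "(Kmap (L (R f)) (R f) (Ident C (K f)) (R (R f)) \<cdot> Kmap (L f) (L (R f)) (L f) (L (R f))) \<cdot> \<sigma> f
      \<sqsubseteq> (R (L (R f)) \<cdot> Kmap (L f) (L (R f)) (L f) (L (R f))) \<cdot> \<sigma> f"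
    using a f L_lax[of "R f"]
    by (intro comp_mono[of _ _ _ _ "K f" "K (L f)" "K (R f)"]
        comp_mono[of _ _ _ _ "K (L f)" "K (L (R f))" "K (R f)"]) (auto simp: hom_iff)
  then show ?thesis
    by (simp only: eq[symmetric] eq')
qed

text \<open>Among endomorphisms over \<open>Rf\<close> that fix the unit \<open>Lf\<close>, the
  identity is least: \<open>1 = \<pi> K(k,1) K(Lf,1) \<le> \<pi> K(k,1) LRf = \<pi> LRf k =
  k\<close>, where the inequality is \<open>R_lax\<close>.\<close>

lemma ident_le_of_unit:
  assumes f: "f \<in> Arr C" and k: "k \<in> hom C (K f) (K f)" and eq: "R f \<cdot> k = R f" "k \<cdot> L f = L f"
  shows "Ident C (K f) \<sqsubseteq> k"
proof -
  let ?y = "Cod C f"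
  have sq: "square (R f) (R f) k (Ident C ?y)"
    using f k eq by (simp add: square_def hom_iff)
  have "Ident C (K f) = \<pi> f \<cdot> Kmap f (R f) (k \<cdot> L f) (Ident C ?y \<cdot> Ident C ?y)"
    using f by (simp add: \<pi>_laws eq)
  also have "\<dots> = \<pi> f \<cdot> (Kmap (R f) (R f) k (Ident C ?y) \<cdot> Kmap f (R f) (L f) (Ident C ?y))"
    using f sq by (simp add: Kmap_comp unit_square)
  also have "\<dots> \<sqsubseteq> \<pi> f \<cdot> (Kmap (R f) (R f) k (Ident C ?y) \<cdot> L (R f))"
    using f R_lax[OF f] Kmap_arr[OF sq] Kmap_arr[OF unit_square[OF f]] \<pi>_laws(1-3)[OF f]
    by (intro comp_mono[of _ _ _ _ "K f" "K (R f)" "K f"]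
        comp_mono[of _ _ _ _ "K f" "K (R f)" "K (R f)"]) (auto simp: hom_iff)
  also have "Kmap (R f) (R f) k (Ident C ?y) \<cdot> L (R f) = L (R f) \<cdot> k"
    by (rule Kmap_L[OF sq])
  also have "\<pi> f \<cdot> (L (R f) \<cdot> k) = (\<pi> f \<cdot> L (R f)) \<cdot> k"
    using f k \<pi>_laws(1-3)[OF f] by (simp add: comp_assoc hom_iff)
  also have "\<dots> = k"
    using f k by (simp add: \<pi>_laws(5) hom_iff)
  finally show ?thesis .
qed

text \<open>The coalgebra structures \<open>(1, s) : f \<rightarrow> Lf\<close>, without coassociativity, which is automatic
  by \<open>Lcoalg_coassoc\<close>.\<close>

definition Lcoalg :: "'a \<Rightarrow> 'a \<Rightarrow> bool" where
  "Lcoalg f s \<longleftrightarrow> f \<in> Arr C \<and> s \<in> Arr C \<and> Dom C s = Cod C f \<and> Cod C s = K f \<and>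
     s \<cdot> f = L f \<and> R f \<cdot> s = Ident C (Cod C f)"

text \<open>The composite \<open>s Rf\<close> lies over \<open>Rf\<close> and fixes
  \<open>Lf\<close>, so \<open>ident_le_of_unit\<close> applies. Together with
  \<open>Rf s = 1\<close> this makes \<open>s\<close> right adjoint to \<open>Rf\<close>.\<close>

lemma Lcoalg_adjoint:
  assumes "Lcoalg f s"
  shows "Ident C (K f) \<sqsubseteq> s \<cdot> R f"
proof (rule ident_le_of_unit)
  have s: "f \<in> Arr C" "s \<in> Arr C" "Dom C s = Cod C f" "Cod C s = K f"
    "s \<cdot> f = L f" "R f \<cdot> s = Ident C (Cod C f)"
    using assms by (auto simp: Lcoalg_def)
  then show "f \<in> Arr C" "s \<cdot> R f \<in> hom C (K f) (K f)"
    by (auto simp: hom_iff)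
  have "R f \<cdot> (s \<cdot> R f) = (R f \<cdot> s) \<cdot> R f"
    using s(1-4) by (simp add: comp_assoc)
  then show "R f \<cdot> (s \<cdot> R f) = R f"
    using s by simp
  show "(s \<cdot> R f) \<cdot> L f = L f"
    using s by (simp add: comp_assoc)
qed

lemma Lcoalg_unique:
  assumes "Lcoalg f s" "Lcoalg f s'"
  shows "s = s'"
  using assms Lcoalg_adjoint[of f]
  by (intro right_adjoint_unique[of "R f" "K f" "Cod C f"]) (auto simp: Lcoalg_def hom_iff)

lemma Lcoalg_cofree: "f \<in> Arr C \<Longrightarrow> Lcoalg (L f) (\<sigma> f)"
  by (simp add: Lcoalg_def \<sigma>_laws)

text \<open>Both sides of coassociativity are right adjoint to \<open>Rf \<cdot> R(Lf) = Rf \<cdot> K(1, Rf)\<close>.\<close>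

lemma Lcoalg_coassoc:
  assumes "Lcoalg f s"
  shows "\<sigma> f \<cdot> s = Kmap f (L f) (Ident C (Dom C f)) s \<cdot> s"
proof -
  let ?x = "Dom C f" and ?y = "Cod C f"
  let ?K = "Kmap f (L f) (Ident C ?x) s" and ?Q = "Kmap (L f) f (Ident C ?x) (R f)"
  have s: "f \<in> Arr C" "s \<in> Arr C" "Dom C s = Cod C f" "Cod C s = K f"
    "s \<cdot> f = L f" "R f \<cdot> s = Ident C ?y"
    using assms by (auto simp: Lcoalg_def)
  note f = s(1) and \<sigma> = \<sigma>_laws[OF f]
  have sq: "square f (L f) (Ident C ?x) s"
    using s by (simp add: square_def)
  have sq': "square (L f) (L f) (Ident C ?x) (s \<cdot> R f)"
    using square_paste[OF counit_square[OF f] sq] f by simp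
  note K = Kmap_arr[OF sq] and Q = Kmap_arr[OF counit_square[OF f]]
  note arrs = s(1-4) \<sigma>(1-3) K Q
  \<comment> \<open>Two forms of one left adjoint. The arrow \<open>R(Lf)\<close> is left adjoint to
    \<open>\<sigma> f\<close>, which suits \<open>\<sigma> f s\<close>, and \<open>?Q\<close> is
    left adjoint to \<open>?K\<close>, which suits \<open>?K s\<close>.\<close>
  have e: "R f \<cdot> R (L f) = R f \<cdot> ?Q"
    by (rule Kmap_R[OF counit_square[OF f], symmetric])
  have QK: "?Q \<cdot> ?K = Ident C (K f)"
    using Kmap_comp[OF sq counit_square[OF f]] s by simp
  have KQ: "?K \<cdot> ?Q = Kmap (L f) (L f) (Ident C ?x) (s \<cdot> R f)"
    using Kmap_comp[OF counit_square[OF f] sq] s by simp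
  show ?thesis
  proof (rule right_adjoint_unique[of "R f \<cdot> R (L f)" "K (L f)" ?y])
    show "R f \<cdot> R (L f) \<in> hom C (K (L f)) ?y" "\<sigma> f \<cdot> s \<in> hom C ?y (K (L f))"
      "?K \<cdot> s \<in> hom C ?y (K (L f))"
      using arrs by (auto simp: hom_iff)
    have "(R f \<cdot> R (L f)) \<cdot> (\<sigma> f \<cdot> s) = R f \<cdot> ((R (L f) \<cdot> \<sigma> f) \<cdot> s)"
      using arrs by (simp add: comp_assoc)
    then show "(R f \<cdot> R (L f)) \<cdot> (\<sigma> f \<cdot> s) \<sqsubseteq> Ident C ?y"
      using s \<sigma> by simp
    have "(R f \<cdot> ?Q) \<cdot> (?K \<cdot> s) = R f \<cdot> ((?Q \<cdot> ?K) \<cdot> s)"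
      using arrs by (simp add: comp_assoc)
    then show "(R f \<cdot> R (L f)) \<cdot> (?K \<cdot> s) \<sqsubseteq> Ident C ?y"
      using s by (simp add: e QK)
    have "\<sigma> f \<cdot> (Ident C (K f) \<cdot> R (L f)) \<sqsubseteq> \<sigma> f \<cdot> ((s \<cdot> R f) \<cdot> R (L f))"
      using arrs Lcoalg_adjoint[OF assms]
      by (intro comp_mono[of _ _ _ _ "K (L f)" "K f" "K (L f)"]
          comp_mono[of _ _ _ _ "K (L f)" "K f" "K f"]) (auto simp: hom_iff)
    then show "Ident C (K (L f)) \<sqsubseteq> (\<sigma> f \<cdot> s) \<cdot> (R f \<cdot> R (L f))"
      using arrs Lcoalg_adjoint[OF Lcoalg_cofree[OF f]]
        leq_trans[of "Ident C (K (L f))" "\<sigma> f \<cdot> R (L f)" _ "K (L f)" "K (L f)"]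
      by (simp add: comp_assoc hom_iff)
    have "?K \<cdot> (Ident C (K f) \<cdot> ?Q) \<sqsubseteq> ?K \<cdot> ((s \<cdot> R f) \<cdot> ?Q)"
      using arrs Lcoalg_adjoint[OF assms]
      by (intro comp_mono[of _ _ _ _ "K (L f)" "K f" "K (L f)"]
          comp_mono[of _ _ _ _ "K (L f)" "K f" "K f"]) (auto simp: hom_iff)
    \<comment> \<open>Monotonicity of \<open>K\<close> on squares carries
      \<open>1 \<le> s Rf\<close> to \<open>1 \<le> ?K ?Q\<close>.\<close>
    moreover have "Ident C (K (L f)) \<sqsubseteq> ?K \<cdot> ?Q"
      using Kmap_mono[OF square_ident[of "L f"], of "Ident C ?x" "s \<cdot> R f"]
        Lcoalg_adjoint[OF assms] sq' f by (simp add: KQ)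
    ultimately show "Ident C (K (L f)) \<sqsubseteq> (?K \<cdot> s) \<cdot> (R f \<cdot> R (L f))"
      using arrs leq_trans[of "Ident C (K (L f))" "?K \<cdot> ?Q" _ "K (L f)" "K (L f)"]
      by (simp add: comp_assoc hom_iff e)
  qed
qed

text \<open>Replaces square-valued structures by single arrows. A counit law makes the upper
  component an identity; conversely, the lower component of coassociativity is
  \<open>Lcoalg_coassoc\<close> and the upper one is trivial.\<close>

lemma coalgebra_iff:
  "coalgebra (arrow_cat C) (Lcomonad C A) (f, a) \<longleftrightarrow>
     (\<exists>s. a = Sq f (L f) (Ident C (Dom C f)) s \<and> Lcoalg f s)"
proof
  assume a: "coalgebra (arrow_cat C) (Lcomonad C A) (f, a)"
  then obtain h s where hs: "a = Sq f (L f) h s" "square f (L f) h s" and f: "f \<in> Arr C"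
    by (auto simp: Lcomonad_def hom_arrow_cat)
  have e: "Ident C (Dom C f) \<cdot> h = Ident C (Dom C f)" "R f \<cdot> s = Ident C (Cod C f)"
    using a hs by (auto simp: Lcomonad_def)
  then have "h = Ident C (Dom C f)"
    using hs f by (simp add: square_def)
  with e hs f show "\<exists>s. a = Sq f (L f) (Ident C (Dom C f)) s \<and> Lcoalg f s"
    by (auto simp: Lcoalg_def square_def)
next
  assume "\<exists>s. a = Sq f (L f) (Ident C (Dom C f)) s \<and> Lcoalg f s"
  then obtain s where s: "a = Sq f (L f) (Ident C (Dom C f)) s" "Lcoalg f s"
    by blast
  have "square f (L f) (Ident C (Dom C f)) s"
    using s by (simp add: square_def Lcoalg_def)
  then show "coalgebra (arrow_cat C) (Lcomonad C A) (f, a)"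
    using s Lcoalg_coassoc[OF s(2)] arg_cong[OF Sig_square(1)[of f], of up]
      arg_cong[OF Sig_square(1)[of f], of tgt] by (auto simp: Lcomonad_def hom_arrow_cat Lcoalg_def)
qed

text \<open>The upper components of the two composites agree by the identity laws, so all the
  information is in the lower ones.\<close>

lemma coalgebra_hom_iff:
  "coalgebra_hom (arrow_cat C) (Lcomonad C A)
     (f, Sq f (L f) (Ident C (Dom C f)) s) (g, Sq g (L g) (Ident C (Dom C g)) t) (Sq f g h k) \<longleftrightarrow>
   square f g h k \<and> t \<cdot> k = Kmap f g h k \<cdot> s"
  by (auto simp: Lcomonad_def hom_arrow_cat square_def)

end

section \<open>Composition of coalgebras and of their morphisms\<close>

context lax_orthogonal
begin

lemma is_L_coalgebra_iff: "is_L_coalgebra C A f \<longleftrightarrow> (\<exists>s. Lcoalg f s)"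
  by (auto simp: is_L_coalgebra_def coalgebra_iff simp del: coalgebra.simps)

lemma is_L_coalgebra_hom_iff:
  "is_L_coalgebra_hom C A (Sq f g h k) \<longleftrightarrow>
     square f g h k \<and> (\<exists>s t. Lcoalg f s \<and> Lcoalg g t \<and> t \<cdot> k = Kmap f g h k \<cdot> s)"
  unfolding is_L_coalgebra_hom_def sq.sel coalgebra_iff using coalgebra_hom_iff by blast

text \<open>\<open>Lcomp f s g t\<close> is the coalgebra structure on \<open>g \<cdot> f\<close> built from structures \<open>s\<close> on \<open>f\<close>
  and \<open>t\<close> on \<open>g\<close>.\<close>

definition Lcomp :: "'a \<Rightarrow> 'a \<Rightarrow> 'a \<Rightarrow> 'a \<Rightarrow> 'a" where
  "Lcomp f s g t = \<pi> (g \<cdot> f) \<cdot>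
     (Kmap g (R (g \<cdot> f)) (Kmap f (g \<cdot> f) (Ident C (Dom C f)) g \<cdot> s) (Ident C (Cod C g)) \<cdot> t)"

text \<open>Typing of the formula for \<open>Lcomp\<close>: since
  \<open>R(gf) K(1,g) s = g Rf s = g\<close>, the arrow \<open>K(1,g) s\<close> is the upper side of
  a square from \<open>g\<close> to \<open>R(gf)\<close>.\<close>

lemma Lcomp_squares:
  assumes "Lcoalg f s" "Lcoalg g t" "Cod C f = Dom C g"
  shows "square f (g \<cdot> f) (Ident C (Dom C f)) g"
    and "square g (R (g \<cdot> f)) (Kmap f (g \<cdot> f) (Ident C (Dom C f)) g \<cdot> s) (Ident C (Cod C g))"
proof -
  let ?K = "Kmap f (g \<cdot> f) (Ident C (Dom C f)) g"
  have s: "f \<in> Arr C" "s \<in> Arr C" "Dom C s = Dom C g" "Cod C s = K f"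
    "R f \<cdot> s = Ident C (Dom C g)" and g: "g \<in> Arr C"
    using assms by (auto simp: Lcoalg_def)
  show sq: "square f (g \<cdot> f) (Ident C (Dom C f)) g"
    using s g assms(3) by (simp add: square_def)
  note K = Kmap_arr[OF sq]
  have "R (g \<cdot> f) \<cdot> (?K \<cdot> s) = (R (g \<cdot> f) \<cdot> ?K) \<cdot> s"
    using s g K assms(3) by (simp add: comp_assoc)
  also have "\<dots> = g \<cdot> (R f \<cdot> s)"
    using s g K assms(3) by (simp add: Kmap_R[OF sq] comp_assoc)
  finally show "square g (R (g \<cdot> f)) (?K \<cdot> s) (Ident C (Cod C g))"
    using s g K assms(3) by (simp add: square_def)
qed

text \<open>\<open>Lcomp\<close> is the diagonal filler of the square \<open>(K(1,g) s, 1)\<close>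
  from the coalgebra \<open>g\<close> to the free algebra \<open>R(gf)\<close>. Its lower triangle
  is the section law; its upper triangle, followed by \<open>s f = Lf\<close>, gives
  \<open>L(gf)\<close>.\<close>

lemma Lcoalg_comp:
  assumes "Lcoalg f s" "Lcoalg g t" "Cod C f = Dom C g"
  shows "Lcoalg (g \<cdot> f) (Lcomp f s g t)"
proof -
  let ?K = "Kmap f (g \<cdot> f) (Ident C (Dom C f)) g"
  let ?s = "?K \<cdot> s"
  let ?K' = "Kmap g (R (g \<cdot> f)) ?s (Ident C (Cod C g))"
  have s: "f \<in> Arr C" "s \<in> Arr C" "Dom C s = Dom C g" "Cod C s = K f" "s \<cdot> f = L f"
    and t: "g \<in> Arr C" "t \<in> Arr C" "Dom C t = Cod C g" "Cod C t = K g"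
      "t \<cdot> g = L g" "R g \<cdot> t = Ident C (Cod C g)"
    using assms by (auto simp: Lcoalg_def)
  note sq = Lcomp_squares[OF assms]
  have gf: "g \<cdot> f \<in> Arr C"
    using s t assms(3) by simp
  note arrs = s(1-4) t(1-4) assms(3) Kmap_arr[OF sq(1)] Kmap_arr[OF sq(2)] \<pi>_laws(1-3)[OF gf]
  have "Lcomp f s g t \<cdot> (g \<cdot> f) = \<pi> (g \<cdot> f) \<cdot> (?K' \<cdot> ((t \<cdot> g) \<cdot> f))"
    using arrs by (simp add: Lcomp_def comp_assoc)
  also have "\<dots> = \<pi> (g \<cdot> f) \<cdot> ((?K' \<cdot> L g) \<cdot> f)"
    using arrs by (simp add: t(5) comp_assoc)
  also have "\<dots> = \<pi> (g \<cdot> f) \<cdot> ((L (R (g \<cdot> f)) \<cdot> ?s) \<cdot> f)"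
    by (simp only: Kmap_L[OF sq(2)])
  also have "\<dots> = (\<pi> (g \<cdot> f) \<cdot> L (R (g \<cdot> f))) \<cdot> (?K \<cdot> (s \<cdot> f))"
    using arrs by (simp add: comp_assoc)
  also have "\<dots> = ?K \<cdot> L f"
    using arrs by (simp add: \<pi>_laws(5) s(5))
  also have "\<dots> = L (g \<cdot> f)"
    using arrs by (simp add: Kmap_L[OF sq(1)])
  finally have 1: "Lcomp f s g t \<cdot> (g \<cdot> f) = L (g \<cdot> f)" .
  have "R (g \<cdot> f) \<cdot> Lcomp f s g t = (R (g \<cdot> f) \<cdot> \<pi> (g \<cdot> f)) \<cdot> (?K' \<cdot> t)"
    using arrs by (simp add: Lcomp_def comp_assoc)
  also have "\<dots> = (R (R (g \<cdot> f)) \<cdot> ?K') \<cdot> t"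
    using arrs by (simp add: \<pi>_laws(4) comp_assoc)
  also have "\<dots> = Ident C (Cod C g)"
    using arrs t(6) by (simp add: Kmap_R[OF sq(2)])
  finally have "R (g \<cdot> f) \<cdot> Lcomp f s g t = Ident C (Cod C g)" .
  with 1 show ?thesis
    using arrs by (simp add: Lcoalg_def) (simp add: Lcomp_def)
qed

text \<open>The filler is natural. The squares are moved past \<open>s\<close>, \<open>t\<close>,
  the two instances of \<open>K\<close> and \<open>\<pi>\<close> one factor at a time, by the
  hypotheses, functoriality and \<open>\<pi>_natural\<close> respectively.\<close>

lemma Lcoalg_comp_hom:
  assumes f: "Lcoalg f s" "Lcoalg f' s'" "square f f' h k" "s' \<cdot> k = Kmap f f' h k \<cdot> s"
    and g: "Lcoalg g t" "Lcoalg g' t'" "square g g' k l" "t' \<cdot> l = Kmap g g' k l \<cdot> t"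
    and c: "Cod C f = Dom C g" "Cod C f' = Dom C g'"
  shows "square (g \<cdot> f) (g' \<cdot> f') h l"
    and "Lcomp f' s' g' t' \<cdot> l = Kmap (g \<cdot> f) (g' \<cdot> f') h l \<cdot> Lcomp f s g t"
proof -
  let ?K = "Kmap f (g \<cdot> f) (Ident C (Dom C f)) g"
    and ?J = "Kmap f' (g' \<cdot> f') (Ident C (Dom C f')) g'"
    and ?P = "Kmap (g \<cdot> f) (g' \<cdot> f') h l"
  let ?K' = "Kmap g (R (g \<cdot> f)) (?K \<cdot> s) (Ident C (Cod C g))"
    and ?J' = "Kmap g' (R (g' \<cdot> f')) (?J \<cdot> s') (Ident C (Cod C g'))"
    and ?Q = "Kmap (R (g \<cdot> f)) (R (g' \<cdot> f')) ?P l"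
  have s: "f \<in> Arr C" "s \<in> Arr C" "Dom C s = Dom C g" "Cod C s = K f"
    "g \<in> Arr C" "t \<in> Arr C" "Dom C t = Cod C g" "Cod C t = K g"
    "f' \<in> Arr C" "s' \<in> Arr C" "Dom C s' = Dom C g'" "Cod C s' = K f'"
    "g' \<in> Arr C" "t' \<in> Arr C" "Dom C t' = Cod C g'" "Cod C t' = K g'"
    using f g c by (auto simp: Lcoalg_def)
  have h: "h \<in> Arr C" "Dom C h = Dom C f" "Cod C h = Dom C f'"
    "k \<in> Arr C" "Dom C k = Dom C g" "Cod C k = Dom C g'"
    "l \<in> Arr C" "Dom C l = Cod C g" "Cod C l = Cod C g'" "f' \<cdot> h = k \<cdot> f" "g' \<cdot> k = l \<cdot> g"
    using f g c by (auto simp: square_def)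
  have "(g' \<cdot> f') \<cdot> h = (g' \<cdot> k) \<cdot> f"
    using s h(1-10) c by (simp add: comp_assoc)
  then show sq: "square (g \<cdot> f) (g' \<cdot> f') h l"
    using s h(1-9,11) c by (simp add: square_def comp_assoc)
  note sq1 = Lcomp_squares[OF f(1) g(1) c(1)] and sq2 = Lcomp_squares[OF f(2) g(2) c(2)]
  have gf: "g \<cdot> f \<in> Arr C" "g' \<cdot> f' \<in> Arr C"
    using s c by simp_all
  note arrs = s h(1-9) c Kmap_arr[OF sq1(1)] Kmap_arr[OF sq1(2)] Kmap_arr[OF sq2(1)]
    Kmap_arr[OF sq2(2)] \<pi>_laws(1-3)[OF gf(1)] \<pi>_laws(1-3)[OF gf(2)] Kmap_arr[OF sq]
    Kmap_arr[OF R_square[OF sq]] Kmap_arr[OF f(3)] Kmap_arr[OF g(3)]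
  have "?P \<cdot> (?K \<cdot> s) = (?P \<cdot> ?K) \<cdot> s"
    using arrs by (simp add: comp_assoc)
  also have "?P \<cdot> ?K = ?J \<cdot> Kmap f f' h k"
    using arrs by (simp add: Kmap_comp[OF sq1(1) sq] Kmap_comp[OF f(3) sq2(1)] h(11))
  also have "(?J \<cdot> Kmap f f' h k) \<cdot> s = ?J \<cdot> (s' \<cdot> k)"
    using arrs by (simp add: comp_assoc f(4))
  finally have eq: "?P \<cdot> (?K \<cdot> s) = (?J \<cdot> s') \<cdot> k"
    using arrs by (simp add: comp_assoc)
  have eq': "?Q \<cdot> ?K' = ?J' \<cdot> Kmap g g' k l"
    using arrs eq by (simp add: Kmap_comp[OF sq1(2) R_square[OF sq]] Kmap_comp[OF g(3) sq2(2)])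
  have "?P \<cdot> Lcomp f s g t = (?P \<cdot> \<pi> (g \<cdot> f)) \<cdot> (?K' \<cdot> t)"
    using arrs by (simp add: Lcomp_def comp_assoc)
  also have "\<dots> = \<pi> (g' \<cdot> f') \<cdot> ((?Q \<cdot> ?K') \<cdot> t)"
    using arrs by (simp add: \<pi>_natural[OF sq] comp_assoc)
  also have "\<dots> = \<pi> (g' \<cdot> f') \<cdot> (?J' \<cdot> (Kmap g g' k l \<cdot> t))"
    using arrs by (simp add: eq' comp_assoc)
  also have "\<dots> = \<pi> (g' \<cdot> f') \<cdot> (?J' \<cdot> (t' \<cdot> l))"
    by (simp only: g(4))
  also have "\<dots> = Lcomp f' s' g' t' \<cdot> l"
    using arrs by (simp add: Lcomp_def comp_assoc)
  finally show "Lcomp f' s' g' t' \<cdot> l = ?P \<cdot> Lcomp f s g t" by simp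
qed

section \<open>LARIs as coalgebras of a sub-LARI system\<close>

lemma is_comma_factor:
  "is_comma C f g x p q \<Longrightarrow> y \<in> Obj C \<Longrightarrow> u \<in> hom C y (Dom C f) \<Longrightarrow> v \<in> hom C y (Dom C g) \<Longrightarrow>
    f \<cdot> u \<sqsubseteq> g \<cdot> v \<Longrightarrow> \<exists>!h. h \<in> hom C y x \<and> p \<cdot> h = u \<and> q \<cdot> h = v"
  unfolding is_comma_def by blast

text \<open>The arrow \<open>s\<close> into the comma-object, with components \<open>g\<close> and
  \<open>1\<close>, is the E-coalgebra structure of the LARI \<open>f\<close>. The comonad morphism
  gives \<open>\<phi> Ef = Lf\<close> and \<open>Rf \<phi> = Mf\<close>, which push this structure
  forward to \<open>L\<close>.\<close>

lemma lari_Lcoalg: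
  assumes EM: "comma_awfs C EM r" and \<phi>: "awfs_morphism C EM A \<phi>"
    and f: "f \<in> Arr C" and s: "s \<in> hom C (Cod C f) (fob (Kfun EM) f)"
    and g: "g = r f \<cdot> s" "g \<cdot> f = Ident C (Dom C f)" and M: "Rpart EM f \<cdot> s = Ident C (Cod C f)"
  shows "Lcoalg f (\<phi> f \<cdot> s)"
proof -
  have comma: "is_comma C f (Ident C (Cod C f)) (fob (Kfun EM) f) (r f) (Rpart EM f)"
    and E: "Lpart EM f \<in> hom C (Dom C f) (fob (Kfun EM) f)"
      "Rpart EM f \<cdot> Lpart EM f = f" "r f \<cdot> Lpart EM f = Ident C (Dom C f)"
    using EM f by (auto simp: comma_awfs_def Let_def)
  have "nat_trans (arrow_cat C) C (Kfun EM) (Kfun A) \<phi>"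
    using \<phi> by (simp add: awfs_morphism_def)
  from nat_trans_hom[OF this, of f] have \<phi>f: "\<phi> f \<in> hom C (fob (Kfun EM) f) (K f)"
    using f by simp
  have cm: "comonad_morphism (arrow_cat C) (Lcomonad C EM) (Lcomonad C A)
       (\<lambda>f. Sq (Lpart EM f) (Lpart A f) (Ident C (Dom C f)) (\<phi> f))"
    using \<phi> by (simp add: awfs_morphism_def)
  then have "square (Lpart EM f) (L f) (Ident C (Dom C f)) (\<phi> f)"
    using nat_trans_hom[of "arrow_cat C" "arrow_cat C" "Lcomonad C EM" "Lcomonad C A" _ f] f
    by (auto simp: comonad_morphism_def Lcomonad_def hom_arrow_cat)
  then have \<phi>E: "\<phi> f \<cdot> Lpart EM f = L f"
    using f by (simp add: square_def)
  have "counit (Lcomonad C A) f \<cdot>\<^bsub>arrow_cat C\<^esub>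
      Sq (Lpart EM f) (Lpart A f) (Ident C (Dom C f)) (\<phi> f) = counit (Lcomonad C EM) f"
    using cm f by (simp add: comonad_morphism_def del: arrow_cat_simps(5))
  then have R\<phi>: "R f \<cdot> \<phi> f = Rpart EM f"
    by (simp add: Lcomonad_def)
  have rM: "r f \<in> hom C (fob (Kfun EM) f) (Dom C f)"
    "Rpart EM f \<in> hom C (fob (Kfun EM) f) (Cod C f)"
    using comma f by (auto simp: is_comma_def)
  note arrs = f s E(1) \<phi>f rM
  have "f \<cdot> Ident C (Dom C f) \<sqsubseteq> Ident C (Cod C f) \<cdot> f"
    using f by simp
  \<comment> \<open>Both \<open>s f\<close> and \<open>Ef\<close> solve the factorisation problem
    for the pair \<open>(1, f)\<close>, hence they coincide.\<close>
  then have uniq: "\<exists>!h. h \<in> hom C (Dom C f) (fob (Kfun EM) f) \<and>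
      r f \<cdot> h = Ident C (Dom C f) \<and> Rpart EM f \<cdot> h = f"
    using is_comma_factor[OF comma, of "Dom C f" "Ident C (Dom C f)" f] f by (auto simp: hom_iff)
  have "r f \<cdot> (s \<cdot> f) = Ident C (Dom C f)"
    using arrs g by (simp add: comp_assoc hom_iff)
  moreover have "Rpart EM f \<cdot> (s \<cdot> f) = (Rpart EM f \<cdot> s) \<cdot> f"
    using arrs by (simp add: comp_assoc hom_iff)
  moreover have "s \<cdot> f \<in> hom C (Dom C f) (fob (Kfun EM) f)"
    using arrs by (simp add: hom_iff)
  ultimately have "s \<cdot> f = Lpart EM f"
    using uniq E arrs M by (metis comp_ident(1))
  moreover have "(\<phi> f \<cdot> s) \<cdot> f = \<phi> f \<cdot> (s \<cdot> f)"
    using arrs by (simp add: comp_assoc hom_iff)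
  moreover have "R f \<cdot> (\<phi> f \<cdot> s) = (R f \<cdot> \<phi> f) \<cdot> s"
    using arrs by (simp add: comp_assoc hom_iff)
  ultimately show ?thesis
    using arrs \<phi>E R\<phi> M by (simp add: Lcoalg_def hom_iff)
qed

text \<open>The inequality \<open>f g \<le> 1\<close> is exactly the condition for the pair
  \<open>(g, 1)\<close> to factor through the comma-object.\<close>

lemma lari_comma_section:
  assumes EM: "comma_awfs C EM r"
    and f: "f \<in> Arr C" and g: "g \<in> hom C (Cod C f) (Dom C f)" and fg: "f \<cdot> g \<sqsubseteq> Ident C (Cod C f)"
  obtains s where "s \<in> hom C (Cod C f) (fob (Kfun EM) f)" "r f \<cdot> s = g"
    "Rpart EM f \<cdot> s = Ident C (Cod C f)"
proof -
  have "is_comma C f (Ident C (Cod C f)) (fob (Kfun EM) f) (r f) (Rpart EM f)"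
    using EM f by (auto simp: comma_awfs_def Let_def)
  from is_comma_factor[OF this, of "Cod C f" g "Ident C (Cod C f)"] show thesis
    using f g fg that by (auto simp: hom_iff)
qed

lemma sub_lari_Lcoalg:
  assumes "sub_lari C A" "f \<in> Arr C" "g \<in> hom C (Cod C f) (Dom C f)"
    and "g \<cdot> f = Ident C (Dom C f)" "f \<cdot> g \<sqsubseteq> Ident C (Cod C f)"
  shows "\<exists>s. Lcoalg f s"
proof -
  obtain EM r \<phi> where EM: "comma_awfs C EM r" "awfs_morphism C EM A \<phi>"
    using assms(1) by (auto simp: sub_lari_def)
  obtain s where s: "s \<in> hom C (Cod C f) (fob (Kfun EM) f)" "r f \<cdot> s = g"
    "Rpart EM f \<cdot> s = Ident C (Cod C f)"
    using lari_comma_section[OF EM(1) assms(2,3,5)] .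
  show ?thesis
    using lari_Lcoalg[OF EM assms(2) s(1) s(2)[symmetric] assms(4) s(3)] by blast
qed

text \<open>By uniqueness \<open>t\<close> and \<open>t'\<close> are the structures induced from the
  comma-objects. There \<open>h g = g' k\<close> becomes \<open>?k s = s' k\<close>, and naturality
  of \<open>\<phi>\<close> transfers this equation to \<open>L\<close>.\<close>

lemma sub_lari_Lcoalg_hom:
  assumes "sub_lari C A" and sq: "square f f' h k"
    and g: "g \<in> hom C (Cod C f) (Dom C f)" "g \<cdot> f = Ident C (Dom C f)"
      "f \<cdot> g \<sqsubseteq> Ident C (Cod C f)"
    and g': "g' \<in> hom C (Cod C f') (Dom C f')" "g' \<cdot> f' = Ident C (Dom C f')"
      "f' \<cdot> g' \<sqsubseteq> Ident C (Cod C f')"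
    and hg: "h \<cdot> g = g' \<cdot> k" and t: "Lcoalg f t" "Lcoalg f' t'"
  shows "t' \<cdot> k = Kmap f f' h k \<cdot> t"
proof -
  obtain EM r \<phi> where EM: "comma_awfs C EM r" "awfs_morphism C EM A \<phi>"
    using assms(1) by (auto simp: sub_lari_def)
  let ?K = "fob (Kfun EM)" and ?k = "far (Kfun EM) (Sq f f' h k)"
  have f: "f \<in> Arr C" "f' \<in> Arr C" and hk: "h \<in> hom C (Dom C f) (Dom C f')"
      "k \<in> hom C (Cod C f) (Cod C f')"
    using sq by (auto simp: square_def hom_iff)
  obtain s where s: "s \<in> hom C (Cod C f) (?K f)" "r f \<cdot> s = g" "Rpart EM f \<cdot> s = Ident C (Cod C f)"
    using lari_comma_section[OF EM(1) f(1) g(1,3)] .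
  obtain s' where s': "s' \<in> hom C (Cod C f') (?K f')" "r f' \<cdot> s' = g'"
      "Rpart EM f' \<cdot> s' = Ident C (Cod C f')"
    using lari_comma_section[OF EM(1) f(2) g'(1,3)] .
  have t_eq: "t = \<phi> f \<cdot> s" "t' = \<phi> f' \<cdot> s'"
    using lari_Lcoalg[OF EM f(1) s(1) s(2)[symmetric] g(2) s(3)]
      lari_Lcoalg[OF EM f(2) s'(1) s'(2)[symmetric] g'(2) s'(3)] Lcoalg_unique t by auto
  have comma: "is_comma C f (Ident C (Cod C f)) (?K f) (r f) (Rpart EM f)"
    "is_comma C f' (Ident C (Cod C f')) (?K f') (r f') (Rpart EM f')"
    using EM f by (auto simp: comma_awfs_def Let_def)
  have k: "?k \<in> hom C (?K f) (?K f')" "r f' \<cdot> ?k = h \<cdot> r f" "Rpart EM f' \<cdot> ?k = k \<cdot> Rpart EM f"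
    using EM(1) sq unfolding comma_awfs_def Let_def
    by (metis hom_arrow_cat sq.sel(3,4))+
  have nt: "nat_trans (arrow_cat C) C (Kfun EM) (Kfun A) \<phi>"
    using EM by (simp add: awfs_morphism_def)
  have \<phi>: "\<phi> f \<in> hom C (?K f) (K f)" "\<phi> f' \<in> hom C (?K f') (K f')"
    using nat_trans_hom[OF nt] f by auto
  have \<phi>_nat: "Kmap f f' h k \<cdot> \<phi> f = \<phi> f' \<cdot> ?k"
    using nat_trans_eq[OF nt, of "Sq f f' h k" f f'] sq by (simp add: hom_arrow_cat)
  have rM: "r f \<in> hom C (?K f) (Dom C f)" "Rpart EM f \<in> hom C (?K f) (Cod C f)"
    "r f' \<in> hom C (?K f') (Dom C f')" "Rpart EM f' \<in> hom C (?K f') (Cod C f')"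
    using comma f by (auto simp: is_comma_def)
  note arrs = f hk s(1) s'(1) k(1) \<phi> rM g(1) g'(1) Kmap_arr[OF sq]
  have "r f' \<cdot> (?k \<cdot> s) = (h \<cdot> r f) \<cdot> s"
    using arrs by (simp add: k(2)[symmetric] comp_assoc hom_iff)
  also have "\<dots> = g' \<cdot> k"
    using arrs by (simp add: comp_assoc hom_iff s(2) hg)
  finally have 1: "r f' \<cdot> (?k \<cdot> s) = r f' \<cdot> (s' \<cdot> k)"
    using arrs by (simp add: comp_assoc[symmetric] hom_iff s'(2))
  have "Rpart EM f' \<cdot> (?k \<cdot> s) = (k \<cdot> Rpart EM f) \<cdot> s"
    using arrs by (simp add: k(3)[symmetric] comp_assoc hom_iff)
  also have "\<dots> = k"
    using arrs by (simp add: comp_assoc hom_iff s(3))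
  finally have 2: "Rpart EM f' \<cdot> (?k \<cdot> s) = Rpart EM f' \<cdot> (s' \<cdot> k)"
    using arrs by (simp add: comp_assoc[symmetric] hom_iff s'(3))
  \<comment> \<open>The two-dimensional property of the comma-object; used in both directions, with
    antisymmetry, it compares two arrows by their projections.\<close>
  have order: "\<And>h h'. h \<in> hom C (Cod C f) (?K f') \<Longrightarrow> h' \<in> hom C (Cod C f) (?K f') \<Longrightarrow>
      r f' \<cdot> h \<sqsubseteq> r f' \<cdot> h' \<Longrightarrow> Rpart EM f' \<cdot> h \<sqsubseteq> Rpart EM f' \<cdot> h' \<Longrightarrow> h \<sqsubseteq> h'"
    using comma(2) f unfolding is_comma_def by (meson Cod_Obj)
  have homs: "?k \<cdot> s \<in> hom C (Cod C f) (?K f')" "s' \<cdot> k \<in> hom C (Cod C f) (?K f')"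
    using arrs by (auto simp: hom_iff)
  have "?k \<cdot> s = s' \<cdot> k"
    using order[of "?k \<cdot> s" "s' \<cdot> k"] order[of "s' \<cdot> k" "?k \<cdot> s"] homs arrs
    by (intro Leq_antisym[OF homs]) (auto simp: 1 2 hom_iff)
  then have "\<phi> f' \<cdot> (s' \<cdot> k) = (\<phi> f' \<cdot> ?k) \<cdot> s"
    using arrs by (simp add: comp_assoc hom_iff)
  then show ?thesis
    using arrs by (simp add: t_eq \<phi>_nat[symmetric] comp_assoc hom_iff)
qed

end

section \<open>Isomorphisms and adjunctions over a base\<close>

lemma over_cat_simps [simp]:
  "Obj (over_cat B S U H) = S"
  "Dom (over_cat B S U H) = osrc"
  "Cod (over_cat B S U H) = otgt"
  "Ident (over_cat B S U H) p = Over p p (Ident B (U p))"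
  "k \<cdot>\<^bsub>over_cat B S U H\<^esub> h = Over (osrc h) (otgt k) (und k \<cdot>\<^bsub>B\<^esub> und h)"
  "h \<sqsubseteq>\<^bsub>over_cat B S U H\<^esub> k \<longleftrightarrow> und h \<sqsubseteq>\<^bsub>B\<^esub> und k"
  by (simp_all add: over_cat_def)

lemma over_cat_Arr:
  "h \<in> Arr (over_cat B S U H) \<longleftrightarrow> osrc h \<in> S \<and> otgt h \<in> S \<and>
     und h \<in> hom B (U (osrc h)) (U (otgt h)) \<and> H (osrc h) (otgt h) (und h)"
  by (cases h) (auto simp: over_cat_def)

lemma over_cat_hom:
  "h \<in> hom (over_cat B S U H) p q \<longleftrightarrow>
     (\<exists>k. h = Over p q k \<and> p \<in> S \<and> q \<in> S \<and> k \<in> hom B (U p) (U q) \<and> H p q k)"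
  by (cases h) (auto simp: hom_def over_cat_Arr)

lemma forgetful_simps [simp]: "fob (forgetful U) = U" "far (forgetful U) = und"
  by (simp_all add: forgetful_def)

lemma comp_fun_simps [simp]:
  "fob (comp_fun G F) x = fob G (fob F x)" "far (comp_fun G F) f = far G (far F f)"
  by (simp_all add: comp_fun_def)

lemma id_fun_simps [simp]: "fob id_fun x = x" "far id_fun f = f"
  by (simp_all add: id_fun_def)

text \<open>Injectivity of \<open>U\<close> and \<open>V\<close> says that structures are
  properties. An isomorphism over \<open>B\<close> is then forced to match structures on the same
  object, and as the order comes from \<open>B\<close>, only the predicates on arrows remain to be
  compared.\<close>

lemma iso_over_over_cat:
  assumes inj: "inj_on U S" "inj_on V S'" and img: "U ` S = V ` S'"
    and H: "\<And>p q p' q' h. p \<in> S \<Longrightarrow> q \<in> S \<Longrightarrow> p' \<in> S' \<Longrightarrow> q' \<in> S' \<Longrightarrow> U p = V p' \<Longrightarrow> U q = V q' \<Longrightarrow>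
      h \<in> hom B (U p) (U q) \<Longrightarrow> H p q h \<longleftrightarrow> H' p' q' h"
  shows "iso_over (over_cat B S U H) (over_cat B S' V H') (forgetful U) (forgetful V)"
proof -
  define \<phi> where "\<phi> p = inv_into S' V (U p)" for p
  define \<psi> where "\<psi> p = inv_into S U (V p)" for p
  have "U p \<in> V ` S'" if "p \<in> S" for p
    using that img by blast
  then have \<phi>: "\<phi> p \<in> S'" "V (\<phi> p) = U p" if "p \<in> S" for p
    using that by (simp_all add: \<phi>_def inv_into_into f_inv_into_f)
  have "V p \<in> U ` S" if "p \<in> S'" for p
    using that img by blast
  then have \<psi>: "\<psi> p \<in> S" "U (\<psi> p) = V p" if "p \<in> S'" for p
    using that by (simp_all add: \<psi>_def inv_into_into f_inv_into_f)
  have \<psi>\<phi>: "\<psi> (\<phi> p) = p" if "p \<in> S" for p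
    using that \<phi> \<psi> inj(1) by (metis inj_onD)
  have \<phi>\<psi>: "\<phi> (\<psi> p) = p" if "p \<in> S'" for p
    using that \<phi> \<psi> inj(2) by (metis inj_onD)
  let ?F = "\<lparr>fob = \<phi>, far = \<lambda>h. Over (\<phi> (osrc h)) (\<phi> (otgt h)) (und h)\<rparr>"
    and ?G = "\<lparr>fob = \<psi>, far = \<lambda>h. Over (\<psi> (osrc h)) (\<psi> (otgt h)) (und h)\<rparr>"
  have "ofunctor (over_cat B S U H) (over_cat B S' V H') ?F"
    using \<phi> H[OF _ _ \<phi>(1) \<phi>(1) \<phi>(2)[symmetric] \<phi>(2)[symmetric]]
    by (auto simp: ofunctor_def over_cat_hom)
  moreover have "ofunctor (over_cat B S' V H') (over_cat B S U H) ?G"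
    using \<psi> H[OF \<psi>(1) \<psi>(1) _ _ \<psi>(2) \<psi>(2)]
    by (auto simp: ofunctor_def over_cat_hom)
  ultimately show ?thesis
    unfolding iso_over_def using \<phi> \<phi>\<psi> \<psi>\<phi>
    by (intro exI[of _ ?F] exI[of _ ?G]) (auto simp: over_cat_Arr)
qed

text \<open>The new right adjoint is \<open>F G\<close> with the old counit, and the unit is the old
  one conjugated by the isomorphism. The two forgetful functors are related by
  \<open>V F = U\<close>, hence \<open>U I = V\<close>.\<close>

lemma has_right_adjoint_iso_over:
  fixes P :: "('p, 'b) ocat" and Q :: "('q, 'c) ocat" and B :: "('o, 'a) ocat"
  assumes Q: "\<And>f x y. f \<in> hom Q x y \<Longrightarrow> x \<in> Obj Q \<and> y \<in> Obj Q" and U: "ofunctor P B U"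
    and iso: "iso_over P Q U V" and adj: "has_right_adjoint P B U"
  shows "has_right_adjoint Q B V"
proof -
  obtain F :: "('p, 'b, 'q, 'c) ofun" and I :: "('q, 'c, 'p, 'b) ofun"
    where F: "ofunctor P Q F" and I: "ofunctor Q P I"
    and IF: "\<And>x. x \<in> Obj P \<Longrightarrow> fob I (fob F x) = x"
    and FI: "\<And>y. y \<in> Obj Q \<Longrightarrow> fob F (fob I y) = y" "\<And>g. g \<in> Arr Q \<Longrightarrow> far F (far I g) = g"
    and VF: "\<And>x. x \<in> Obj P \<Longrightarrow> fob V (fob F x) = fob U x"
      "\<And>f. f \<in> Arr P \<Longrightarrow> far V (far F f) = far U f"
    using iso unfolding iso_over_def by blast
  obtain G :: "('o, 'a, 'p, 'b) ofun" and \<eta> \<epsilon> where G: "ofunctor B P G"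
    and \<eta>: "nat_trans P P id_fun (comp_fun G U) \<eta>" and \<epsilon>: "nat_trans B B (comp_fun U G) id_fun \<epsilon>"
    and tri: "\<And>x. x \<in> Obj P \<Longrightarrow> \<epsilon> (fob U x) \<cdot>\<^bsub>B\<^esub> far U (\<eta> x) = Ident B (fob U x)"
      "\<And>y. y \<in> Obj B \<Longrightarrow> far G (\<epsilon> y) \<cdot>\<^bsub>P\<^esub> \<eta> (fob G y) = Ident P (fob G y)"
    using adj unfolding has_right_adjoint_def by blast
  have UI: "fob U (fob I y) = fob V y" if "y \<in> Obj Q" for y
    using that VF(1) FI(1) ofunctor_ob[OF I] by metis
  have UI': "far U (far I f) = far V f" if "f \<in> hom Q x y" for f x y
    using VF(2)[of "far I f"] FI(2)[of f] ofunctor_hom[OF I that] that by (simp add: hom_def)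
  have \<eta>_hom: "\<eta> x \<in> hom P x (fob G (fob U x))" if "x \<in> Obj P" for x
    using nat_trans_hom[OF \<eta> that] by simp
  have \<epsilon>_hom: "\<epsilon> y \<in> hom B (fob U (fob G y)) y" if "y \<in> Obj B" for y
    using nat_trans_hom[OF \<epsilon> that] by simp
  let ?G = "comp_fun F G" and ?\<eta> = "\<lambda>y. far F (\<eta> (fob I y))"
  have "ofunctor B Q ?G"
    unfolding ofunctor_def
  proof (intro conjI allI ballI impI)
    fix x y z f g
    assume f: "f \<in> hom B x y"
    show "far ?G f \<in> hom Q (fob ?G x) (fob ?G y)"
      using ofunctor_hom[OF F ofunctor_hom[OF G f]] by simp
    assume "g \<in> hom B y z"
    then show "far ?G (g \<cdot>\<^bsub>B\<^esub> f) = far ?G g \<cdot>\<^bsub>Q\<^esub> far ?G f"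
      using ofunctor_comp[OF G f] ofunctor_comp[OF F ofunctor_hom[OF G f]] ofunctor_hom[OF G]
      by (metis comp_fun_simps(2))
  next
    fix x y f g
    assume "f \<in> hom B x y" "g \<in> hom B x y" "f \<sqsubseteq>\<^bsub>B\<^esub> g"
    then show "far ?G f \<sqsubseteq>\<^bsub>Q\<^esub> far ?G g"
      using ofunctor_mono[OF F ofunctor_hom[OF G] ofunctor_hom[OF G]] ofunctor_mono[OF G] by simp
  qed (use ofunctor_ob[OF G] ofunctor_ob[OF F] ofunctor_ident[OF G] ofunctor_ident[OF F] in simp_all)
  moreover have "nat_trans Q Q id_fun (comp_fun ?G V) ?\<eta>"
    unfolding nat_trans_def
  proof (intro conjI allI ballI)
    fix y assume y: "y \<in> Obj Q"
    show "?\<eta> y \<in> hom Q (fob id_fun y) (fob (comp_fun ?G V) y)"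
      using ofunctor_hom[OF F \<eta>_hom[OF ofunctor_ob[OF I y]]] by (simp add: FI(1) UI y)
  next
    fix x y f assume f: "f \<in> hom Q x y"
    then have xy: "x \<in> Obj Q" "y \<in> Obj Q"
      using Q by auto
    note If = ofunctor_hom[OF I f]
    have GUIf: "far G (far U (far I f)) \<in> hom P (fob G (fob U (fob I x))) (fob G (fob U (fob I y)))"
      using ofunctor_hom[OF G ofunctor_hom[OF U If]] .
    have "far F (far G (far U (far I f))) \<cdot>\<^bsub>Q\<^esub> ?\<eta> x = far F (far G (far U (far I f)) \<cdot>\<^bsub>P\<^esub> \<eta> (fob I x))"
      using ofunctor_comp[OF F \<eta>_hom GUIf] ofunctor_ob[OF I xy(1)] by simp
    also have "far G (far U (far I f)) \<cdot>\<^bsub>P\<^esub> \<eta> (fob I x) = \<eta> (fob I y) \<cdot>\<^bsub>P\<^esub> far I f"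
      using nat_trans_eq[OF \<eta> If] by simp
    also have "far F (\<eta> (fob I y) \<cdot>\<^bsub>P\<^esub> far I f) = ?\<eta> y \<cdot>\<^bsub>Q\<^esub> far F (far I f)"
      using ofunctor_comp[OF F If \<eta>_hom] ofunctor_ob[OF I xy(2)] by simp
    finally show "far (comp_fun ?G V) f \<cdot>\<^bsub>Q\<^esub> ?\<eta> x = ?\<eta> y \<cdot>\<^bsub>Q\<^esub> far id_fun f"
      using FI(2)[of f] f by (simp add: UI'[OF f] hom_def)
  qed
  moreover have "nat_trans B B (comp_fun V ?G) id_fun \<epsilon>"
    unfolding nat_trans_def
  proof (intro conjI allI ballI)
    fix b assume "b \<in> Obj B"
    then show "\<epsilon> b \<in> hom B (fob (comp_fun V ?G) b) (fob id_fun b)"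
      using \<epsilon>_hom VF(1) ofunctor_ob[OF G] by simp
  next
    fix x y f assume f: "f \<in> hom B x y"
    then show "far id_fun f \<cdot>\<^bsub>B\<^esub> \<epsilon> x = \<epsilon> y \<cdot>\<^bsub>B\<^esub> far (comp_fun V ?G) f"
      using nat_trans_eq[OF \<epsilon> f] VF(2)[of "far G f"] ofunctor_hom[OF G f] by (simp add: hom_def)
  qed
  moreover have "\<epsilon> (fob V y) \<cdot>\<^bsub>B\<^esub> far V (?\<eta> y) = Ident B (fob V y)" if "y \<in> Obj Q" for y
    using tri(1)[of "fob I y"] ofunctor_ob[OF I that] UI[OF that] VF(2)[of "\<eta> (fob I y)"]
      \<eta>_hom[of "fob I y"] by (simp add: hom_def)
  moreover have "far ?G (\<epsilon> b) \<cdot>\<^bsub>Q\<^esub> ?\<eta> (fob ?G b) = Ident Q (fob ?G b)" if "b \<in> Obj B" for b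
    using tri(2)[OF that] ofunctor_ident[OF F, of "fob G b"] ofunctor_ob[OF G that]
      ofunctor_comp[OF F \<eta>_hom[of "fob G b"] ofunctor_hom[OF G \<epsilon>_hom[OF that]]]
    by (simp add: IF)
  ultimately show ?thesis
    unfolding has_right_adjoint_def by (intro exI[of _ ?G] exI[of _ ?\<eta>] exI[of _ \<epsilon>]) blast
qed

text \<open>The cofree adjunction: the unit at a coalgebra is its own structure map, which is a
  coalgebra morphism into the cofree one by coassociativity. Transport of this adjunction gives
  fibrant KZ-generation.\<close>

lemma coalg_cat_has_right_adjoint:
  assumes "ord_category B" and W: "ord_comonad B W"
  shows "has_right_adjoint (coalg_cat B W) B (forgetful fst)"
proof -
  interpret ord_category B by fact
  have WF: "ofunctor B B W" and \<epsilon>: "nat_trans B B W id_fun (counit W)"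
    and \<delta>: "nat_trans B B W (comp_fun W W) (comult W)"
    and laws: "\<And>x. x \<in> Obj B \<Longrightarrow> counit W (fob W x) \<cdot>\<^bsub>B\<^esub> comult W x = Ident B (fob W x)"
        "\<And>x. x \<in> Obj B \<Longrightarrow> far W (counit W x) \<cdot>\<^bsub>B\<^esub> comult W x = Ident B (fob W x)"
        "\<And>x. x \<in> Obj B \<Longrightarrow> comult W (fob W x) \<cdot>\<^bsub>B\<^esub> comult W x =
          far W (comult W x) \<cdot>\<^bsub>B\<^esub> comult W x"
    using W by (simp_all add: ord_comonad_def)
  have W_ob: "x \<in> Obj B \<Longrightarrow> fob W x \<in> Obj B" for x
    by (rule ofunctor_ob[OF WF])
  have \<epsilon>_hom: "x \<in> Obj B \<Longrightarrow> counit W x \<in> hom B (fob W x) x"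
    and \<delta>_hom: "x \<in> Obj B \<Longrightarrow> comult W x \<in> hom B (fob W x) (fob W (fob W x))" for x
    using nat_trans_hom[OF \<epsilon>] nat_trans_hom[OF \<delta>] by simp_all
  have obj: "x \<in> Obj B \<and> y \<in> Obj B" if "f \<in> hom B x y" for f x y
    using that by (auto simp: hom_iff)
  have \<epsilon>_nat: "f \<cdot>\<^bsub>B\<^esub> counit W x = counit W y \<cdot>\<^bsub>B\<^esub> far W f"
    and \<delta>_nat: "far W (far W f) \<cdot>\<^bsub>B\<^esub> comult W x = comult W y \<cdot>\<^bsub>B\<^esub> far W f"
    if "f \<in> hom B x y" for f x y
    using nat_trans_eq[OF \<epsilon> that] nat_trans_eq[OF \<delta> that] by simp_all
  let ?cofree = "\<lambda>x. (fob W x, comult W x)"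
  let ?G = "\<lparr>fob = ?cofree, far = \<lambda>f. Over (?cofree (Dom B f)) (?cofree (Cod B f)) (far W f)\<rparr>"
  let ?\<eta> = "\<lambda>p. Over p (?cofree (fst p)) (snd p)"
  note coalg_hom = coalg_cat_def over_cat_hom
  have cofree: "coalgebra B W (?cofree x)" if "x \<in> Obj B" for x
    using that W_ob \<delta>_hom laws by simp
  have "ofunctor B (coalg_cat B W) ?G"
    unfolding ofunctor_def
  proof (intro conjI allI ballI impI)
    fix x y f
    assume f: "f \<in> hom B x y"
    then show "far ?G f \<in> hom (coalg_cat B W) (fob ?G x) (fob ?G y)"
      using cofree obj[OF f] \<delta>_nat[OF f] ofunctor_hom[OF WF f]
      by (auto simp: coalg_hom hom_iff[of f] simp del: coalgebra.simps)
  next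
    fix x y z f g
    assume "f \<in> hom B x y" "g \<in> hom B y z"
    then show "far ?G (g \<cdot>\<^bsub>B\<^esub> f) = far ?G g \<cdot>\<^bsub>coalg_cat B W\<^esub> far ?G f"
      using ofunctor_comp[OF WF] by (simp add: coalg_cat_def hom_iff)
  qed (use W_ob cofree ofunctor_mono[OF WF] ofunctor_ident[OF WF] in \<open>auto simp: coalg_cat_def simp del: coalgebra.simps\<close>)
  moreover have "nat_trans (coalg_cat B W) (coalg_cat B W) id_fun (comp_fun ?G (forgetful fst)) ?\<eta>"
    using cofree by (auto simp: nat_trans_def coalg_hom) (auto simp: hom_iff)
  moreover have "nat_trans B B (comp_fun (forgetful fst) ?G) id_fun (counit W)"
    using \<epsilon>_hom \<epsilon>_nat by (simp add: nat_trans_def)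
  moreover have "\<forall>p\<in>Obj (coalg_cat B W). counit W (fob (forgetful fst) p) \<cdot>\<^bsub>B\<^esub> far (forgetful fst) (?\<eta> p) =
      Ident B (fob (forgetful fst) p)"
    by (auto simp: coalg_cat_def)
  moreover have "\<forall>y\<in>Obj B. far ?G (counit W y) \<cdot>\<^bsub>coalg_cat B W\<^esub> ?\<eta> (fob ?G y) =
      Ident (coalg_cat B W) (fob ?G y)"
    using \<epsilon>_hom laws(2) by (auto simp: coalg_cat_def hom_iff)
  ultimately show ?thesis
    unfolding has_right_adjoint_def by (intro exI[of _ ?G] exI[of _ ?\<eta>] exI[of _ "counit W"]) blast
qed

lemma ofunctor_forgetful: "ofunctor (over_cat B S U H) B (forgetful U)" if "U ` S \<subseteq> Obj B"
  using that by (auto simp: ofunctor_def over_cat_hom)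

section \<open>Cancellation of embeddings\<close>

lemma (in ord_category) emb_objects_iff:
  "(f, r) \<in> emb_objects C T \<longleftrightarrow>
     f \<in> Arr C \<and> r \<in> hom C (fob T (Cod C f)) (fob T (Dom C f)) \<and>
     r \<cdot> mmult T (Cod C f) = mmult T (Dom C f) \<cdot> far T r \<and>
     r \<cdot> far T f = Ident C (fob T (Dom C f)) \<and> far T f \<cdot> r \<sqsubseteq> Ident C (fob T (Cod C f))"
  by (auto simp: emb_objects_def free_algebra_def)

lemma (in ord_category) ofunctor_arr:
  assumes "ofunctor C C T" "f \<in> Arr C"
  shows "far T f \<in> Arr C" "Dom C (far T f) = fob T (Dom C f)" "Cod C (far T f) = fob T (Cod C f)"
  using ofunctor_hom[OF assms(1), of f "Dom C f" "Cod C f"] assms(2) by (simp_all add: hom_iff)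

text \<open>The arrow \<open>r\<close> is right adjoint to \<open>Tf\<close>, with an equality as
  unit.\<close>

lemma (in ord_category) emb_unique:
  assumes T: "ofunctor C C T" and r: "(f, r) \<in> emb_objects C T" "(f, r') \<in> emb_objects C T"
  shows "r = r'"
proof (rule right_adjoint_unique)
  show "far T f \<in> hom C (fob T (Dom C f)) (fob T (Cod C f))"
    using r(1) ofunctor_arr[OF T, of f] by (simp add: emb_objects_iff hom_iff)
qed (use r ofunctor_ob[OF T] in \<open>auto simp: emb_objects_iff hom_iff\<close>)

text \<open>The retraction \<open>q Tg\<close> is an algebra morphism because \<open>q\<close> and
  \<open>Tg\<close> are. Inserting \<open>s Tg = 1\<close> makes the inequality for
  \<open>gf\<close> applicable:
  \<open>Tf q Tg = s Tg Tf q Tg = s T(gf) q Tg \<le> s Tg = 1\<close>.\<close>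

lemma (in ord_category) emb_cancel:
  assumes T: "ord_monad C T"
    and g: "(g, s) \<in> emb_objects C T" and gf: "(g \<cdot> f, q) \<in> emb_objects C T"
    and f: "f \<in> Arr C" "Cod C f = Dom C g"
  shows "(f, q \<cdot> far T g) \<in> emb_objects C T"
proof -
  have TF: "ofunctor C C T" and \<mu>: "nat_trans C C (comp_fun T T) T (mmult T)"
    using T by (auto simp: ord_monad_def)
  let ?x = "Dom C f" and ?y = "Dom C g" and ?z = "Cod C g"
  have gA: "g \<in> Arr C"
    using g by (simp add: emb_objects_iff)
  have s: "s \<in> Arr C" "Dom C s = fob T ?z" "Cod C s = fob T ?y"
      "s \<cdot> far T g = Ident C (fob T ?y)" "far T g \<cdot> s \<sqsubseteq> Ident C (fob T ?z)"
    using g by (auto simp: emb_objects_iff hom_iff)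
  have q: "q \<in> Arr C" "Dom C q = fob T ?z" "Cod C q = fob T ?x"
      "q \<cdot> mmult T ?z = mmult T ?x \<cdot> far T q" "q \<cdot> far T (g \<cdot> f) = Ident C (fob T ?x)"
      "far T (g \<cdot> f) \<cdot> q \<sqsubseteq> Ident C (fob T ?z)"
    using gf f gA by (auto simp: emb_objects_iff hom_iff)
  have Tgf: "far T (g \<cdot> f) = far T g \<cdot> far T f"
    using ofunctor_comp[OF TF, of f ?x ?y g ?z] f gA by (simp add: hom_iff)
  note Tf = ofunctor_arr[OF TF f(1)] and Tg = ofunctor_arr[OF TF gA] and Tq = ofunctor_arr[OF TF q(1)]
  note TTg = ofunctor_arr[OF TF Tg(1)]
  have mu_arr: "mmult T x \<in> Arr C" "Dom C (mmult T x) = fob T (fob T x)" "Cod C (mmult T x) = fob T x"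
    if "x \<in> Obj C" for x
    using nat_trans_hom[OF \<mu> that] by (auto simp: hom_iff)
  have mu_nat: "far T g \<cdot> mmult T ?y = mmult T ?z \<cdot> far T (far T g)"
    using nat_trans_eq[OF \<mu>, of g ?y ?z] gA by (simp add: hom_iff)
  note arrs = f gA s(1-3) q(1-3) Tf Tg Tq TTg mu_arr[of ?x] mu_arr[of ?y] mu_arr[of ?z]
    ofunctor_ob[OF TF]
  have "(q \<cdot> far T g) \<cdot> mmult T ?y = (q \<cdot> mmult T ?z) \<cdot> far T (far T g)"
    using arrs by (simp add: comp_assoc mu_nat)
  also have "\<dots> = mmult T ?x \<cdot> far T (q \<cdot> far T g)"
    using arrs ofunctor_comp[OF TF, of "far T g" "fob T ?y" "fob T ?z" q "fob T ?x"]
    by (simp add: q(4) comp_assoc hom_iff)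
  finally have 1: "(q \<cdot> far T g) \<cdot> mmult T ?y = mmult T ?x \<cdot> far T (q \<cdot> far T g)" .
  have 2: "(q \<cdot> far T g) \<cdot> far T f = Ident C (fob T ?x)"
    using arrs q(5) by (simp add: Tgf comp_assoc)
  have "far T f \<cdot> (q \<cdot> far T g) = (s \<cdot> far T g) \<cdot> (far T f \<cdot> (q \<cdot> far T g))"
    using arrs s(4) by simp
  also have "\<dots> = s \<cdot> ((far T (g \<cdot> f) \<cdot> q) \<cdot> far T g)"
    using arrs by (simp add: Tgf comp_assoc)
  finally have 3: "far T f \<cdot> (q \<cdot> far T g) = s \<cdot> ((far T (g \<cdot> f) \<cdot> q) \<cdot> far T g)" .
  have "s \<cdot> ((far T (g \<cdot> f) \<cdot> q) \<cdot> far T g) \<sqsubseteq> s \<cdot> (Ident C (fob T ?z) \<cdot> far T g)"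
    using arrs q(6)
    by (intro comp_mono[of _ _ _ _ "fob T ?y" "fob T ?z" "fob T ?y"]
        comp_mono[of _ _ _ _ "fob T ?y" "fob T ?z" "fob T ?z"]) (auto simp: hom_iff Tgf)
  then have "far T f \<cdot> (q \<cdot> far T g) \<sqsubseteq> Ident C (fob T ?y)"
    using arrs s(4) by (simp add: 3)
  then show ?thesis
    using arrs 1 2 by (simp add: emb_objects_iff hom_iff)
qed

text \<open>An isomorphism over the arrow category keeps underlying arrows and squares, so both
  cancellation conditions may be checked for embeddings, where \<open>emb_cancel\<close> gives
  explicit structures.\<close>

lemma (in lax_orthogonal) cancellative_if_kz_reflective:
  assumes "kz_reflective C A"
  shows "cancellative C A"
proof -
  obtain T where T: "ord_monad C T"
    and iso: "iso_over (coalg_cat (arrow_cat C) (Lcomonad C A)) (emb_cat C T)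
          (forgetful fst) (forgetful fst)"
    using assms by (auto simp: kz_reflective_def)
  have TF: "ofunctor C C T"
    using T by (simp add: ord_monad_def)
  let ?P = "coalg_cat (arrow_cat C) (Lcomonad C A)" and ?Q = "emb_cat C T"
  obtain F :: "('a \<times> 'a sq, ('a \<times> 'a sq, 'a sq) over, 'a \<times> 'a, ('a \<times> 'a, 'a sq) over) ofun"
    and G :: "('a \<times> 'a, ('a \<times> 'a, 'a sq) over, 'a \<times> 'a sq, ('a \<times> 'a sq, 'a sq) over) ofun"
    where F: "ofunctor ?P ?Q F" and G: "ofunctor ?Q ?P G"
    and FG: "\<And>y. y \<in> Obj ?Q \<Longrightarrow> fob F (fob G y) = y" "\<And>g. g \<in> Arr ?Q \<Longrightarrow> far F (far G g) = g"
    and UF: "\<And>p. p \<in> Obj ?P \<Longrightarrow> fst (fob F p) = fst p" "\<And>h. h \<in> Arr ?P \<Longrightarrow> und (far F h) = und h"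
    using iso unfolding iso_over_def forgetful_simps by blast
  \<comment> \<open>The isomorphism is only stated to commute with the forgetful functors along
    \<open>F\<close>; for its inverse this follows from \<open>F G = 1\<close>.\<close>
  have UG: "fst (fob G y) = fst y" if "y \<in> Obj ?Q" for y
    using UF(1) FG(1) ofunctor_ob[OF G] that by metis
  have obj: "is_L_coalgebra C A f \<longleftrightarrow> (\<exists>r. (f, r) \<in> emb_objects C T)" for f
  proof
    assume "is_L_coalgebra C A f"
    then obtain a where "(f, a) \<in> Obj ?P"
      by (auto simp: is_L_coalgebra_def coalg_cat_def)
    with ofunctor_ob[OF F this] UF(1)[OF this] show "\<exists>r. (f, r) \<in> emb_objects C T"
      by (cases "fob F (f, a)") (auto simp: emb_cat_def)
  next
    assume "\<exists>r. (f, r) \<in> emb_objects C T"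
    then obtain r where "(f, r) \<in> Obj ?Q"
      by (auto simp: emb_cat_def)
    with ofunctor_ob[OF G this] UG[OF this] show "is_L_coalgebra C A f"
      by (cases "fob G (f, r)") (auto simp: coalg_cat_def is_L_coalgebra_def simp del: coalgebra.simps)
  qed
  have arr: "is_L_coalgebra_hom C A (Sq f g h k) \<longleftrightarrow> square f g h k \<and>
      (\<exists>r t. (f, r) \<in> emb_objects C T \<and> (g, t) \<in> emb_objects C T \<and> far T h \<cdot> r = t \<cdot> far T k)"
    for f g h k
  proof
    assume "is_L_coalgebra_hom C A (Sq f g h k)"
    then obtain a b where ab: "Over (f, a) (g, b) (Sq f g h k) \<in> hom ?P (f, a) (g, b)"
      by (auto simp: is_L_coalgebra_hom_def coalg_cat_def over_cat_hom
          simp del: coalgebra.simps)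
    then have P: "(f, a) \<in> Obj ?P" "(g, b) \<in> Obj ?P" "Over (f, a) (g, b) (Sq f g h k) \<in> Arr ?P"
      by (auto simp: coalg_cat_def over_cat_hom over_cat_Arr
          simp del: coalgebra.simps coalgebra_hom.simps)
    obtain r t where rt: "fob F (f, a) = (f, r)" "fob F (g, b) = (g, t)"
      using UF(1)[OF P(1)] UF(1)[OF P(2)] by (metis fst_conv prod.exhaust)
    from ofunctor_hom[OF F ab] UF(2)[OF P(3)]
    have "square f g h k" "(f, r) \<in> emb_objects C T" "(g, t) \<in> emb_objects C T"
      "far T h \<cdot> r = t \<cdot> far T k"
      unfolding rt by (auto simp: emb_cat_def over_cat_hom hom_arrow_cat)
    then show "square f g h k \<and>
      (\<exists>r t. (f, r) \<in> emb_objects C T \<and> (g, t) \<in> emb_objects C T \<and> far T h \<cdot> r = t \<cdot> far T k)"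
      by blast
  next
    assume "square f g h k \<and>
      (\<exists>r t. (f, r) \<in> emb_objects C T \<and> (g, t) \<in> emb_objects C T \<and> far T h \<cdot> r = t \<cdot> far T k)"
    then obtain r t where rt: "Over (f, r) (g, t) (Sq f g h k) \<in> hom ?Q (f, r) (g, t)"
      by (auto simp: emb_cat_def over_cat_hom hom_arrow_cat)
    then have Q: "(f, r) \<in> Obj ?Q" "(g, t) \<in> Obj ?Q" "Over (f, r) (g, t) (Sq f g h k) \<in> Arr ?Q"
      by (auto simp: emb_cat_def over_cat_hom over_cat_Arr)
    obtain a b where ab: "fob G (f, r) = (f, a)" "fob G (g, t) = (g, b)"
      using UG[OF Q(1)] UG[OF Q(2)] by (metis fst_conv prod.exhaust)
    note Gh = ofunctor_hom[OF G rt, unfolded ab]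
    have "und (far G (Over (f, r) (g, t) (Sq f g h k))) = Sq f g h k"
      using UF(2)[of "far G (Over (f, r) (g, t) (Sq f g h k))"] FG(2)[OF Q(3)] Gh
      by (simp add: hom_def)
    with Gh have "coalgebra (arrow_cat C) (Lcomonad C A) (f, a)"
      "coalgebra (arrow_cat C) (Lcomonad C A) (g, b)"
      "coalgebra_hom (arrow_cat C) (Lcomonad C A) (f, a) (g, b) (Sq f g h k)"
      by (auto simp: coalg_cat_def over_cat_hom simp del: coalgebra.simps coalgebra_hom.simps)
    then show "is_L_coalgebra_hom C A (Sq f g h k)"
      unfolding is_L_coalgebra_hom_def sq.sel by blast
  qed
  show ?thesis
    unfolding cancellative_def
  proof (intro conjI allI ballI impI; (elim conjE)?)
    fix x y z f g
    assume "f \<in> hom C x y" "g \<in> hom C y z" "is_L_coalgebra C A g" "is_L_coalgebra C A (g \<cdot> f)"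
    then show "is_L_coalgebra C A f"
      using emb_cancel[OF T] by (fastforce simp: obj hom_iff)
  next
    fix x y z x' y' z' f g f' g' u v w
    assume hom: "f \<in> hom C x y" "g \<in> hom C y z" "f' \<in> hom C x' y'" "g' \<in> hom C y' z'"
        "u \<in> hom C x x'" "v \<in> hom C y y'" "w \<in> hom C z z'"
      and eq: "f' \<cdot> u = v \<cdot> f" "g' \<cdot> v = w \<cdot> g"
      and vw: "is_L_coalgebra_hom C A (Sq g g' v w)"
      and uw: "is_L_coalgebra_hom C A (Sq (g \<cdot> f) (g' \<cdot> f') u w)"
    obtain s s' where s: "(g, s) \<in> emb_objects C T" "(g', s') \<in> emb_objects C T"
      using vw unfolding arr by blast
    obtain q q' where q: "(g \<cdot> f, q) \<in> emb_objects C T" "(g' \<cdot> f', q') \<in> emb_objects C T"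
      and uq: "far T u \<cdot> q = q' \<cdot> far T w"
      using uw unfolding arr by blast
    have r: "(f, q \<cdot> far T g) \<in> emb_objects C T" "(f', q' \<cdot> far T g') \<in> emb_objects C T"
      using emb_cancel[OF T s(1) q(1)] emb_cancel[OF T s(2) q(2)] hom by (auto simp: hom_iff)
    have A: "f \<in> Arr C" "g \<in> Arr C" "f' \<in> Arr C" "g' \<in> Arr C" "u \<in> Arr C" "v \<in> Arr C" "w \<in> Arr C"
      "Dom C u = x" "Dom C v = y" "Dom C w = z" "Cod C u = x'" "Cod C v = y'" "Cod C w = z'"
      "Dom C f = x" "Cod C f = y" "Dom C f' = x'" "Cod C f' = y'" "Dom C g = y" "Cod C g = z"
      "Dom C g' = y'" "Cod C g' = z'"
      using hom by (auto simp: hom_iff)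
    have qA: "q \<in> Arr C" "Dom C q = fob T z" "Cod C q = fob T x"
      "q' \<in> Arr C" "Dom C q' = fob T z'" "Cod C q' = fob T x'"
      using q A by (auto simp: emb_objects_iff hom_iff)
    note TA = ofunctor_arr[OF TF A(2)] ofunctor_arr[OF TF A(4)] ofunctor_arr[OF TF A(5)]
      ofunctor_arr[OF TF A(6)] ofunctor_arr[OF TF A(7)]
    \<comment> \<open>With the explicit structures \<open>q Tg\<close> and \<open>q' Tg'\<close>,
      compatibility with \<open>(u, v)\<close> is compatibility of \<open>q\<close>,
      \<open>q'\<close> with \<open>(u, w)\<close> precomposed with \<open>Tg\<close>, since
      \<open>wg = g'v\<close>.\<close>
    have "far T u \<cdot> (q \<cdot> far T g) = (q' \<cdot> far T w) \<cdot> far T g"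
      using A qA TA by (simp add: uq[symmetric] comp_assoc)
    also have "\<dots> = q' \<cdot> far T (w \<cdot> g)"
      using A qA TA ofunctor_comp[OF TF hom(2,7)] by (simp add: comp_assoc)
    also have "\<dots> = (q' \<cdot> far T g') \<cdot> far T v"
      using A qA TA ofunctor_comp[OF TF hom(6,4)] by (simp add: eq(2)[symmetric] comp_assoc)
    finally show "is_L_coalgebra_hom C A (Sq f f' u v)"
      unfolding arr using r A eq(1) by (auto simp: square_def)
  qed
qed

section \<open>Embeddings obtained by transposing arrows into free algebras\<close>

context ord_category
begin

lemma ord_monad_laws:
  assumes "ord_monad C T"
  shows "ofunctor C C T"
    and "x \<in> Obj C \<Longrightarrow> munit T x \<in> hom C x (fob T x)"
    and "x \<in> Obj C \<Longrightarrow> mmult T x \<in> hom C (fob T (fob T x)) (fob T x)"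
    and "f \<in> hom C x y \<Longrightarrow> far T f \<cdot> munit T x = munit T y \<cdot> f"
    and "f \<in> hom C x y \<Longrightarrow> far T f \<cdot> mmult T x = mmult T y \<cdot> far T (far T f)"
    and "x \<in> Obj C \<Longrightarrow> mmult T x \<cdot> far T (munit T x) = Ident C (fob T x)"
    and "x \<in> Obj C \<Longrightarrow> mmult T x \<cdot> mmult T (fob T x) = mmult T x \<cdot> far T (mmult T x)"
proof -
  have "nat_trans C C id_fun T (munit T)" "nat_trans C C (comp_fun T T) T (mmult T)"
    using assms by (simp_all add: ord_monad_def)
  note nt = nat_trans_hom[OF this(1)] nat_trans_hom[OF this(2)]
    nat_trans_eq[OF this(1)] nat_trans_eq[OF this(2)]
  show "ofunctor C C T"
    and "x \<in> Obj C \<Longrightarrow> munit T x \<in> hom C x (fob T x)"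
    and "x \<in> Obj C \<Longrightarrow> mmult T x \<in> hom C (fob T (fob T x)) (fob T x)"
    and "f \<in> hom C x y \<Longrightarrow> far T f \<cdot> munit T x = munit T y \<cdot> f"
    and "f \<in> hom C x y \<Longrightarrow> far T f \<cdot> mmult T x = mmult T y \<cdot> far T (far T f)"
    and "x \<in> Obj C \<Longrightarrow> mmult T x \<cdot> far T (munit T x) = Ident C (fob T x)"
    and "x \<in> Obj C \<Longrightarrow> mmult T x \<cdot> mmult T (fob T x) = mmult T x \<cdot> far T (mmult T x)"
    using assms nt(1,2)[of x] nt(3,4)[of f x y] by (auto simp: ord_monad_def)
qed

text \<open>Algebra morphisms from \<open>TY\<close> to \<open>TX\<close> are the transposes
  \<open>\<mu> Tu\<close> of arrows \<open>u\<close> from \<open>Y\<close> to \<open>TX\<close>.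
  Transposing is monotone, so the retraction law and the inequality may be checked before it,
  against the units.\<close>

lemma emb_objectsI:
  assumes T: "ord_monad C T" and f: "f \<in> hom C x y" and u: "u \<in> hom C y (fob T x)"
    and uf: "u \<cdot> f = munit T x" and fu: "far T f \<cdot> u \<sqsubseteq> munit T y"
  shows "(f, mmult T x \<cdot> far T u) \<in> emb_objects C T"
proof -
  note TF = ord_monad_laws(1)[OF T]
  have xy: "x \<in> Obj C" "y \<in> Obj C"
    using f by (auto simp: hom_iff)
  note ob = xy ofunctor_ob[OF TF xy(1)] ofunctor_ob[OF TF xy(2)]
  have homs: "f \<in> hom C x y" "u \<in> hom C y (fob T x)" "far T f \<in> hom C (fob T x) (fob T y)"
    "far T u \<in> hom C (fob T y) (fob T (fob T x))"
    "far T (far T u) \<in> hom C (fob T (fob T y)) (fob T (fob T (fob T x)))"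
    "far T (far T f) \<in> hom C (fob T (fob T x)) (fob T (fob T y))"
    "mmult T x \<in> hom C (fob T (fob T x)) (fob T x)"
    "mmult T (fob T x) \<in> hom C (fob T (fob T (fob T x))) (fob T (fob T x))"
    "far T (mmult T x) \<in> hom C (fob T (fob T (fob T x))) (fob T (fob T x))"
    "mmult T y \<in> hom C (fob T (fob T y)) (fob T y)"
    "munit T y \<in> hom C y (fob T y)" "far T (munit T y) \<in> hom C (fob T y) (fob T (fob T y))"
    "far T (far T f \<cdot> u) \<in> hom C (fob T y) (fob T (fob T y))"
    using f u ob ord_monad_laws(2,3)[OF T] ofunctor_hom[OF TF] Comp_hom by auto
  note arrs = homs[unfolded hom_iff] ob
  have "(mmult T x \<cdot> far T u) \<cdot> mmult T y = mmult T x \<cdot> (mmult T (fob T x) \<cdot> far T (far T u))"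
    using arrs ord_monad_laws(5)[OF T homs(2)] by (simp add: comp_assoc)
  also have "\<dots> = (mmult T x \<cdot> mmult T (fob T x)) \<cdot> far T (far T u)"
    using arrs by (simp add: comp_assoc)
  also have "\<dots> = (mmult T x \<cdot> far T (mmult T x)) \<cdot> far T (far T u)"
    by (simp only: ord_monad_laws(7)[OF T xy(1)])
  also have "\<dots> = mmult T x \<cdot> far T (mmult T x \<cdot> far T u)"
    using arrs ofunctor_comp[OF TF homs(4,7)] by (simp add: comp_assoc)
  finally have 1: "(mmult T x \<cdot> far T u) \<cdot> mmult T y = mmult T x \<cdot> far T (mmult T x \<cdot> far T u)" .
  have "(mmult T x \<cdot> far T u) \<cdot> far T f = mmult T x \<cdot> far T (u \<cdot> f)"
    using arrs ofunctor_comp[OF TF homs(1,2)] by (simp add: comp_assoc)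
  then have 2: "(mmult T x \<cdot> far T u) \<cdot> far T f = Ident C (fob T x)"
    using ord_monad_laws(6)[OF T xy(1)] by (simp add: uf)
  have "far T f \<cdot> (mmult T x \<cdot> far T u) = (far T f \<cdot> mmult T x) \<cdot> far T u"
    using arrs by (simp add: comp_assoc)
  also have "\<dots> = mmult T y \<cdot> far T (far T f \<cdot> u)"
    using arrs ord_monad_laws(5)[OF T f] ofunctor_comp[OF TF homs(2,3)] by (simp add: comp_assoc)
  finally have "far T f \<cdot> (mmult T x \<cdot> far T u) = mmult T y \<cdot> far T (far T f \<cdot> u)" .
  moreover have "mmult T y \<cdot> far T (far T f \<cdot> u) \<sqsubseteq> mmult T y \<cdot> far T (munit T y)"
    using homs ofunctor_mono[OF TF Comp_hom[OF homs(2,3)] homs(11) fu]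
    by (intro Comp_mono_right[of _ "fob T y" "fob T (fob T y)" _ _ "fob T y"]) auto
  ultimately have "far T f \<cdot> (mmult T x \<cdot> far T u) \<sqsubseteq> Ident C (fob T y)"
    using ord_monad_laws(6)[OF T xy(2)] by simp
  then show ?thesis
    using 1 2 arrs by (simp add: emb_objects_iff hom_iff)
qed

text \<open>Transposition is natural in both variables, so morphisms of embeddings can also be
  checked before transposing.\<close>

lemma emb_homI:
  assumes T: "ord_monad C T" and h: "h \<in> hom C x x'" and k: "k \<in> hom C y y'"
    and u: "u \<in> hom C y (fob T x)" "u' \<in> hom C y' (fob T x')" and eq: "far T h \<cdot> u = u' \<cdot> k"
  shows "far T h \<cdot> (mmult T x \<cdot> far T u) = (mmult T x' \<cdot> far T u') \<cdot> far T k"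
proof -
  note TF = ord_monad_laws(1)[OF T]
  have x: "x \<in> Obj C" "x' \<in> Obj C"
    using h by (auto simp: hom_iff)
  note Th = ofunctor_hom[OF TF h]
  note arrs = h k u Th ofunctor_hom[OF TF k] ofunctor_hom[OF TF u(1)] ofunctor_hom[OF TF u(2)]
    ofunctor_hom[OF TF Th] ord_monad_laws(3)[OF T x(1)] ord_monad_laws(3)[OF T x(2)]
  have "far T h \<cdot> (mmult T x \<cdot> far T u) = (far T h \<cdot> mmult T x) \<cdot> far T u"
    using arrs by (simp add: comp_assoc hom_iff)
  also have "\<dots> = mmult T x' \<cdot> far T (far T h \<cdot> u)"
    using arrs ord_monad_laws(5)[OF T h] ofunctor_comp[OF TF u(1) Th]
    by (simp add: comp_assoc hom_iff)
  also have "\<dots> = (mmult T x' \<cdot> far T u') \<cdot> far T k"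
    using arrs ofunctor_comp[OF TF k u(2)] by (simp add: eq comp_assoc hom_iff)
  finally show ?thesis .
qed

end

lemma (in lax_orthogonal) \<sigma>_natural:
  assumes "square f g h k"
  shows "\<sigma> g \<cdot> Kmap f g h k = Kmap (L f) (L g) h (Kmap f g h k) \<cdot> \<sigma> f"
proof -
  have "nat_trans (arrow_cat C) (arrow_cat C) (Lcomonad C A)
      (comp_fun (Lcomonad C A) (Lcomonad C A)) (Sig A)"
    using L_comonad by (simp add: ord_comonad_def Lcomonad_def)
  from nat_trans_eq[OF this, of "Sq f g h k" f g] assms show ?thesis
    by (simp add: hom_arrow_cat Lcomonad_def)
qed

section \<open>The monad of a cancellative system\<close>

locale lax_orthogonal_terminal = lax_orthogonal C A
  for C :: "('o, 'a) ocat" (structure) and A +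
  fixes I :: 'o
  assumes I_Obj [simp]: "I \<in> Obj C"
    and terminal: "x \<in> Obj C \<Longrightarrow> \<exists>!h. h \<in> hom C x I"
begin

definition bang :: "'o \<Rightarrow> 'a" where
  "bang x = (THE h. h \<in> hom C x I)"

lemma bang_arr [simp]:
  assumes "x \<in> Obj C"
  shows "bang x \<in> Arr C" "Dom C (bang x) = x" "Cod C (bang x) = I"
  using theI'[OF terminal[OF assms]] by (auto simp: bang_def hom_iff)

lemma bang_unique:
  assumes "h \<in> Arr C" "Dom C h = x" "Cod C h = I"
  shows "h = bang x"
proof -
  have "x \<in> Obj C"
    using assms Dom_Obj by blast
  then show ?thesis
    using assms terminal[of x] bang_arr[of x] by (metis hom_iff)
qed

text \<open>\<open>R\<close> preserves codomains, so the fibre over \<open>I\<close> is closed under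
  it. This equation turns \<open>K(R(bang x))\<close> into the object \<open>TTx\<close>, and so the
  laws of \<open>R\<close> into laws of \<open>T\<close>.\<close>

lemma R_bang: "x \<in> Obj C \<Longrightarrow> R (bang x) = bang (K (bang x))"
  by (rule bang_unique) simp_all

lemma bang_square:
  assumes "f \<in> Arr C" "h \<in> Arr C" "Dom C h = Dom C f" "Cod C h = x"
    and "k \<in> Arr C" "Dom C k = Cod C f" "Cod C k = I"
  shows "square f (bang x) h k"
proof -
  have x: "x \<in> Obj C"
    using assms Cod_Obj by blast
  have "bang x \<cdot> h = bang (Dom C f)" "k \<cdot> f = bang (Dom C f)"
    by (rule bang_unique; use assms x in simp)+
  then show ?thesis
    using assms x by (simp add: square_def)
qed

text \<open>The restriction of \<open>R\<close> to the fibre of the codomain functor over the terminal object.\<close>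

definition T :: "('o, 'a) monad" where
  "T = \<lparr>fob = (\<lambda>x. K (bang x)),
        far = (\<lambda>h. Kmap (bang (Dom C h)) (bang (Cod C h)) h (Ident C I)),
        munit = (\<lambda>x. L (bang x)),
        mmult = (\<lambda>x. \<pi> (bang x))\<rparr>"

lemma T_simps:
  "fob T x = K (bang x)"
  "h \<in> hom C x y \<Longrightarrow> far T h = Kmap (bang x) (bang y) h (Ident C I)"
  "munit T x = L (bang x)"
  "mmult T x = \<pi> (bang x)"
  by (auto simp: T_def hom_iff)

lemma T_square: "h \<in> hom C x y \<Longrightarrow> square (bang x) (bang y) h (Ident C I)"
  by (rule bang_square) (auto simp: hom_iff)

lemma T_functor: "ofunctor C C T"
  unfolding ofunctor_def
proof (intro conjI allI ballI impI)
  fix x assume x: "x \<in> Obj C"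
  then show "fob T x \<in> Obj C"
    by (simp add: T_simps)
  show "far T (Ident C x) = Ident C (fob T x)"
    using x Ident_hom[OF x] by (simp add: T_simps)
next
  fix x y f assume f: "f \<in> hom C x y"
  show "far T f \<in> hom C (fob T x) (fob T y)"
    using Kmap_arr[OF T_square[OF f]] f by (simp add: T_simps hom_iff[of "Kmap _ _ _ _"])
  fix g assume g: "f \<in> hom C x y" "g \<in> hom C x y" "f \<sqsubseteq> g"
  then show "far T f \<sqsubseteq> far T g"
    using Kmap_mono[OF T_square T_square] by (simp add: T_simps)
next
  fix x y z f g assume fg: "f \<in> hom C x y" "g \<in> hom C y z"
  then show "far T (g \<cdot> f) = far T g \<cdot> far T f"
    using Kmap_comp[OF T_square T_square] Comp_hom[OF fg] by (simp add: T_simps)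
qed

lemma T_monad: "ord_monad C T"
  unfolding ord_monad_def
proof (intro conjI ballI)
  show "ofunctor C C T"
    by (rule T_functor)
  show "nat_trans C C id_fun T (munit T)"
    unfolding nat_trans_def
  proof (intro conjI allI ballI)
    fix x y f assume f: "f \<in> hom C x y"
    then show "far T f \<cdot> munit T x = munit T y \<cdot> far id_fun f"
      using Kmap_L[OF T_square] by (simp add: T_simps)
  qed (simp add: T_simps hom_iff)
  show "nat_trans C C (comp_fun T T) T (mmult T)"
    unfolding nat_trans_def
  proof (intro conjI allI ballI)
    fix x y f assume f: "f \<in> hom C x y"
    then have "x \<in> Obj C" "y \<in> Obj C"
      by (auto simp: hom_iff)
    then show "far T f \<cdot> mmult T x = mmult T y \<cdot> far (comp_fun T T) f"
      using \<pi>_natural[OF T_square[OF f]] ofunctor_hom[OF T_functor f] f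
      by (simp add: T_simps R_bang)
  qed (simp add: T_simps hom_iff \<pi>_laws R_bang[symmetric])
  fix x assume x: "x \<in> Obj C"
  show "mmult T x \<cdot> munit T (fob T x) = Ident C (fob T x)"
    using x \<pi>_laws(5)[of "bang x"] by (simp add: T_simps R_bang)
  show "mmult T x \<cdot> far T (munit T x) = Ident C (fob T x)"
    using x \<pi>_laws(6)[of "bang x"] by (simp add: T_def R_bang)
  show "mmult T x \<cdot> mmult T (fob T x) = mmult T x \<cdot> far T (mmult T x)"
    using x \<pi>_laws[of "bang x"] by (simp add: T_def R_bang)
qed

lemma T_lax: "lax_idempotent_monad C T"
  unfolding lax_idempotent_monad_def
proof
  fix x assume "x \<in> Obj C"
  then show "far T (munit T x) \<sqsubseteq> munit T (fob T x)"
    using R_lax[of "bang x"] by (simp add: T_def R_bang)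
qed

section \<open>From coalgebras to embeddings\<close>

text \<open>The extension \<open>Y \<rightarrow> Kf \<rightarrow> TX\<close> of the unit \<open>X \<rightarrow> TX\<close> along a coalgebra \<open>f : X \<rightarrow> Y\<close>.\<close>

definition coalg_unit :: "'a \<Rightarrow> 'a \<Rightarrow> 'a" where
  "coalg_unit f s = Kmap f (bang (Dom C f)) (Ident C (Dom C f)) (bang (Cod C f)) \<cdot> s"

lemma coalg_unit_square:
  "f \<in> Arr C \<Longrightarrow> square f (bang (Dom C f)) (Ident C (Dom C f)) (bang (Cod C f))"
  by (rule bang_square) simp_all

lemma coalg_unit_hom:
  assumes "Lcoalg f s"
  shows "coalg_unit f s \<in> hom C (Cod C f) (fob T (Dom C f))"
  using assms Kmap_arr[OF coalg_unit_square[of f]]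
  by (auto simp: coalg_unit_def Lcoalg_def hom_iff T_simps)

text \<open>By \<open>emb_objectsI\<close> the essential point is \<open>Tf u \<le> \<eta>\<close>.
  Both sides are images under the same arrow \<open>K(1, bang)\<close> of sections of
  \<open>R(1)\<close> for the identity of \<open>Y\<close>: the left comes from
  \<open>K(f,1) s\<close>, the right from \<open>L(1)\<close>.\<close>

lemma Lcoalg_emb:
  assumes s: "Lcoalg f s"
  shows "(f, mmult T (Dom C f) \<cdot> far T (coalg_unit f s)) \<in> emb_objects C T"
proof (rule emb_objectsI[OF T_monad, of _ _ "Cod C f"])
  let ?x = "Dom C f" and ?y = "Cod C f" and ?u = "coalg_unit f s"
  have f: "f \<in> Arr C" and sA: "s \<in> Arr C" "Dom C s = ?y" "Cod C s = K f"
    "s \<cdot> f = L f" "R f \<cdot> s = Ident C ?y"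
    using s by (auto simp: Lcoalg_def)
  show hom: "f \<in> hom C ?x ?y" "?u \<in> hom C ?y (fob T ?x)"
    using f coalg_unit_hom[OF s] by (auto simp: hom_iff)
  note sq = coalg_unit_square[OF f] and sqT = T_square[OF hom(1)]
  have sq_id: "square (Ident C ?y) (bang ?y) (Ident C ?y) (bang ?y)"
    using coalg_unit_square[of "Ident C ?y"] f by simp
  have sq_f: "square f (Ident C ?y) f (Ident C ?y)"
    using f by (simp add: square_def)
  note arrs = f sA(1-3) Kmap_arr[OF sq] Kmap_arr[OF sqT] Kmap_arr[OF sq_id] Kmap_arr[OF sq_f]
  show "?u \<cdot> f = munit T ?x"
    using arrs sA(4) Kmap_L[OF sq] by (simp add: coalg_unit_def T_simps comp_assoc)
  \<comment> \<open>The identity is a coalgebra with structure \<open>L(1)\<close>, so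
    \<open>1 \<le> L(1) R(1)\<close>. Any section \<open>v\<close> of \<open>R(1)\<close> then
    satisfies \<open>v \<le> L(1) R(1) v = L(1)\<close>.\<close>
  have id: "Lcoalg (Ident C ?y) (L (Ident C ?y))"
    using f by (simp add: Lcoalg_def)
  let ?v = "Kmap f (Ident C ?y) f (Ident C ?y) \<cdot> s"
  have "Ident C (K (Ident C ?y)) \<cdot> ?v \<sqsubseteq> (L (Ident C ?y) \<cdot> R (Ident C ?y)) \<cdot> ?v"
    using arrs Lcoalg_adjoint[OF id]
    by (intro Comp_mono_left[of _ ?y "K (Ident C ?y)" _ "K (Ident C ?y)"]) (auto simp: hom_iff)
  moreover have "(L (Ident C ?y) \<cdot> R (Ident C ?y)) \<cdot> ?v =
      L (Ident C ?y) \<cdot> ((R (Ident C ?y) \<cdot> Kmap f (Ident C ?y) f (Ident C ?y)) \<cdot> s)"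
    using arrs by (simp add: comp_assoc)
  moreover have "\<dots> = L (Ident C ?y)"
    using arrs Kmap_R[OF sq_f] sA(5) by simp
  ultimately have le: "?v \<sqsubseteq> L (Ident C ?y)"
    using arrs by simp
  have "far T f \<cdot> ?u = (Kmap (bang ?x) (bang ?y) f (Ident C I) \<cdot>
      Kmap f (bang ?x) (Ident C ?x) (bang ?y)) \<cdot> s"
    using arrs hom by (simp add: T_simps coalg_unit_def comp_assoc)
  also have "\<dots> = (Kmap (Ident C ?y) (bang ?y) (Ident C ?y) (bang ?y) \<cdot>
      Kmap f (Ident C ?y) f (Ident C ?y)) \<cdot> s"
    using arrs by (simp add: Kmap_comp[OF sq sqT] Kmap_comp[OF sq_f sq_id])
  finally have eq: "far T f \<cdot> ?u = Kmap (Ident C ?y) (bang ?y) (Ident C ?y) (bang ?y) \<cdot> ?v"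
    using arrs by (simp add: comp_assoc)
  have "Kmap (Ident C ?y) (bang ?y) (Ident C ?y) (bang ?y) \<cdot> ?v \<sqsubseteq>
      Kmap (Ident C ?y) (bang ?y) (Ident C ?y) (bang ?y) \<cdot> L (Ident C ?y)"
    using arrs le by (intro Comp_mono_right[of _ ?y "K (Ident C ?y)" _ _ "K (bang ?y)"]) (auto simp: hom_iff)
  then show "far T f \<cdot> ?u \<sqsubseteq> munit T ?y"
    using arrs Kmap_L[OF sq_id] by (simp add: eq T_simps)
qed

text \<open>Before transposition both sides contain \<open>K\<close> of one and the same square,
  from \<open>f\<close> to \<open>bang (Dom C f')\<close>, which factors through
  \<open>bang (Dom C f)\<close> and through \<open>f'\<close>.\<close>

lemma Lcoalg_hom_emb:
  assumes s: "Lcoalg f s" "Lcoalg f' s'" and sq: "square f f' h k"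
    and hk: "s' \<cdot> k = Kmap f f' h k \<cdot> s"
  shows "far T h \<cdot> (mmult T (Dom C f) \<cdot> far T (coalg_unit f s)) =
    (mmult T (Dom C f') \<cdot> far T (coalg_unit f' s')) \<cdot> far T k"
proof (rule emb_homI[OF T_monad _ _ coalg_unit_hom[OF s(1)] coalg_unit_hom[OF s(2)]])
  have f: "f \<in> Arr C" "f' \<in> Arr C" and sA: "s \<in> Arr C" "Dom C s = Cod C f" "Cod C s = K f"
    "s' \<in> Arr C" "Dom C s' = Cod C f'" "Cod C s' = K f'"
    using s by (auto simp: Lcoalg_def)
  show hom: "h \<in> hom C (Dom C f) (Dom C f')" "k \<in> hom C (Cod C f) (Cod C f')"
    using sq by (auto simp: square_def hom_iff)
  note h = hom[unfolded hom_iff]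
  note sq1 = coalg_unit_square[OF f(1)] and sq2 = coalg_unit_square[OF f(2)] and sqT = T_square[OF hom(1)]
  note arrs = f sA h Kmap_arr[OF sq1] Kmap_arr[OF sq2] Kmap_arr[OF sqT] Kmap_arr[OF sq]
  have bk: "bang (Cod C f') \<cdot> k = bang (Cod C f)"
    using f h by (intro bang_unique) auto
  have "far T h \<cdot> coalg_unit f s = (Kmap (bang (Dom C f)) (bang (Dom C f')) h (Ident C I) \<cdot>
      Kmap f (bang (Dom C f)) (Ident C (Dom C f)) (bang (Cod C f))) \<cdot> s"
    using arrs hom by (simp add: T_simps coalg_unit_def comp_assoc)
  also have "\<dots> = (Kmap f' (bang (Dom C f')) (Ident C (Dom C f')) (bang (Cod C f')) \<cdot>
      Kmap f f' h k) \<cdot> s"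
    using arrs by (simp add: Kmap_comp[OF sq1 sqT] Kmap_comp[OF sq sq2] bk)
  also have "\<dots> = coalg_unit f' s' \<cdot> k"
    using arrs by (simp add: coalg_unit_def comp_assoc hk)
  finally show "far T h \<cdot> coalg_unit f s = coalg_unit f' s' \<cdot> k" .
qed

lemma munit_Lcoalg: "x \<in> Obj C \<Longrightarrow> Lcoalg (munit T x) (\<sigma> (bang x))"
  by (simp add: T_simps Lcoalg_cofree)

text \<open>The comonad applied to the square \<open>(h, 1)\<close> over \<open>I\<close> is a
  morphism of cofree coalgebras; here it is seen as a morphism between units of
  \<open>T\<close>.\<close>

lemma munit_hom:
  assumes h: "h \<in> hom C x y"
  shows "square (munit T x) (munit T y) h (far T h)"
    and "\<sigma> (bang y) \<cdot> far T h = Kmap (munit T x) (munit T y) h (far T h) \<cdot> \<sigma> (bang x)"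
  using L_square[OF T_square[OF h]] \<sigma>_natural[OF T_square[OF h]] h by (simp_all add: T_simps)

section \<open>From embeddings to coalgebras\<close>

lemma emb_far_Lcoalg:
  assumes "sub_lari C A" "(f, r) \<in> emb_objects C T"
  shows "\<exists>s. Lcoalg (far T f) s"
  using assms ofunctor_arr[OF T_functor, of f] sub_lari_Lcoalg[of "far T f" r]
  by (auto simp: emb_objects_iff)

lemma emb_Lcoalg:
  assumes c: "cancellative C A" and sl: "sub_lari C A" and r: "(f, r) \<in> emb_objects C T"
  shows "\<exists>s. Lcoalg f s"
proof -
  have f: "f \<in> hom C (Dom C f) (Cod C f)"
    using r by (auto simp: emb_objects_iff hom_iff)
  then have fA: "f \<in> Arr C"
    by (simp add: hom_iff)
  obtain t where t: "Lcoalg (far T f) t"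
    using emb_far_Lcoalg[OF sl r] by blast
  have "is_L_coalgebra C A (far T f \<cdot> munit T (Dom C f))"
    unfolding is_L_coalgebra_iff
    using Lcoalg_comp[OF munit_Lcoalg[of "Dom C f"] t] ofunctor_arr[OF T_functor fA] fA
    by (auto simp: T_simps)
  then have "is_L_coalgebra C A (munit T (Cod C f) \<cdot> f)"
    using ord_monad_laws(4)[OF T_monad f] by simp
  moreover have "is_L_coalgebra C A (munit T (Cod C f))"
    using munit_Lcoalg[of "Cod C f"] fA by (auto simp: is_L_coalgebra_iff)
  moreover have "munit T (Cod C f) \<in> hom C (Cod C f) (fob T (Cod C f))"
    using fA by (simp add: T_simps hom_iff)
  ultimately have "is_L_coalgebra C A f"
    using c f unfolding cancellative_def by blast
  then show ?thesis
    by (simp add: is_L_coalgebra_iff)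
qed

text \<open>The squares \<open>(h, Th)\<close> between units and \<open>(Th, Tk)\<close> between
  LARIs compose to a morphism \<open>(h, Tk)\<close> from \<open>Tf \<eta>\<close> to
  \<open>Tf' \<eta>\<close>. Naturality rewrites these as \<open>\<eta> f\<close> and
  \<open>\<eta> f'\<close>, after which the morphism \<open>(k, Tk)\<close> between the units can be
  cancelled.\<close>

lemma emb_hom_Lcoalg:
  assumes c: "cancellative C A" and sl: "sub_lari C A"
    and r: "(f, r) \<in> emb_objects C T" "(f', r') \<in> emb_objects C T"
    and sq: "square f f' h k" and hk: "far T h \<cdot> r = r' \<cdot> far T k"
  shows "is_L_coalgebra_hom C A (Sq f f' h k)"
proof -
  let ?x = "Dom C f" and ?y = "Cod C f" and ?x' = "Dom C f'" and ?y' = "Cod C f'"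
  have A: "f \<in> Arr C" "f' \<in> Arr C"
    using r by (auto simp: emb_objects_iff)
  have ob: "?x \<in> Obj C" "?y \<in> Obj C" "?x' \<in> Obj C" "?y' \<in> Obj C"
    using A by auto
  have f: "f \<in> hom C ?x ?y" "f' \<in> hom C ?x' ?y'" and h: "h \<in> hom C ?x ?x'" "k \<in> hom C ?y ?y'"
    and eq: "f' \<cdot> h = k \<cdot> f"
    using sq by (auto simp: square_def hom_iff)
  note Tf = ofunctor_hom[OF T_functor f(1)] ofunctor_hom[OF T_functor f(2)]
    ofunctor_hom[OF T_functor h(1)] ofunctor_hom[OF T_functor h(2)]
  obtain t t' where t: "Lcoalg (far T f) t" "Lcoalg (far T f') t'"
    using emb_far_Lcoalg[OF sl r(1)] emb_far_Lcoalg[OF sl r(2)] by blast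
  have Teq: "far T f' \<cdot> far T h = far T k \<cdot> far T f"
    using ofunctor_comp[OF T_functor h(1) f(2)] ofunctor_comp[OF T_functor f(1) h(2)] eq by simp
  have sqT: "square (far T f) (far T f') (far T h) (far T k)"
    using Tf Teq by (simp add: square_def hom_iff)
  have hT: "t' \<cdot> far T k = Kmap (far T f) (far T f') (far T h) (far T k) \<cdot> t"
    using r sub_lari_Lcoalg_hom[OF sl sqT _ _ _ _ _ _ hk t] Tf by (simp add: emb_objects_iff hom_iff)
  have un: "munit T x \<in> hom C x (fob T x)" if "x \<in> Obj C" for x
    using ord_monad_laws(2)[OF T_monad that] .
  have cods: "Cod C (munit T ?x) = Dom C (far T f)" "Cod C (munit T ?x') = Dom C (far T f')"
    using Tf un[OF ob(1)] un[OF ob(3)] by (auto simp: hom_iff)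
  note comp = Lcoalg_comp[OF munit_Lcoalg[OF ob(1)] t(1) cods(1)]
    Lcoalg_comp[OF munit_Lcoalg[OF ob(3)] t(2) cods(2)]
    Lcoalg_comp_hom[OF munit_Lcoalg[OF ob(1)] munit_Lcoalg[OF ob(3)] munit_hom[OF h(1)]
      t sqT hT cods]
  have nat: "far T f \<cdot> munit T ?x = munit T ?y \<cdot> f" "far T f' \<cdot> munit T ?x' = munit T ?y' \<cdot> f'"
    using ord_monad_laws(4)[OF T_monad f(1)] ord_monad_laws(4)[OF T_monad f(2)] .
  have "is_L_coalgebra_hom C A (Sq (munit T ?y \<cdot> f) (munit T ?y' \<cdot> f') h (far T k))"
    unfolding is_L_coalgebra_hom_iff using comp unfolding nat by blast
  moreover have "is_L_coalgebra_hom C A (Sq (munit T ?y) (munit T ?y') k (far T k))"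
    unfolding is_L_coalgebra_hom_iff
    using munit_Lcoalg[OF ob(2)] munit_Lcoalg[OF ob(4)] munit_hom[OF h(2)] by blast
  moreover have "is_L_coalgebra C A (munit T ?y)" "is_L_coalgebra C A (munit T ?y')"
    "is_L_coalgebra C A (munit T ?y \<cdot> f)" "is_L_coalgebra C A (munit T ?y' \<cdot> f')"
    unfolding is_L_coalgebra_iff nat[symmetric]
    using comp(1,2) munit_Lcoalg[OF ob(2)] munit_Lcoalg[OF ob(4)] by blast+
  moreover have "munit T ?y' \<cdot> k = far T k \<cdot> munit T ?y"
    using ord_monad_laws(4)[OF T_monad h(2)] by simp
  ultimately show ?thesis
    using c f h eq un[OF ob(2)] un[OF ob(4)] Tf(4) unfolding cancellative_def by blast
qed

section \<open>The isomorphism of categories and reflectivity\<close>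

lemma coalg_iso_emb:
  assumes c: "cancellative C A" and sl: "sub_lari C A"
  shows "iso_over (coalg_cat (arrow_cat C) (Lcomonad C A)) (emb_cat C T) (forgetful fst) (forgetful fst)"
  unfolding coalg_cat_def emb_cat_def
proof (rule iso_over_over_cat)
  let ?S = "{p. coalgebra (arrow_cat C) (Lcomonad C A) p}"
  show "inj_on fst ?S"
    by (rule inj_onI) (auto simp: coalgebra_iff simp del: coalgebra.simps dest: Lcoalg_unique)
  show "inj_on fst (emb_objects C T)"
    by (rule inj_onI) (auto dest: emb_unique[OF T_functor])
  have "fst ` ?S = {f. \<exists>s. Lcoalg f s}"
    by (force simp: coalgebra_iff image_iff simp del: coalgebra.simps)
  also have "\<dots> = fst ` emb_objects C T"
    using Lcoalg_emb emb_Lcoalg[OF c sl] by (force simp: image_iff)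
  finally show "fst ` ?S = fst ` emb_objects C T" .
next
  fix p q p' q' s
  assume p: "p \<in> {p. coalgebra (arrow_cat C) (Lcomonad C A) p}"
    "q \<in> {p. coalgebra (arrow_cat C) (Lcomonad C A) p}"
    and p': "p' \<in> emb_objects C T" "q' \<in> emb_objects C T" "fst p = fst p'" "fst q = fst q'"
    and s: "s \<in> hom (arrow_cat C) (fst p) (fst q)"
  obtain f a g b where pq: "p = (f, a)" "q = (g, b)"
    by (cases p, cases q)
  then obtain r t where pq': "p' = (f, r)" "q' = (g, t)"
    using p' by (cases p', cases q') auto
  obtain x y where a: "a = Sq f (L f) (Ident C (Dom C f)) x" "Lcoalg f x"
    and b: "b = Sq g (L g) (Ident C (Dom C g)) y" "Lcoalg g y"
    using p pq by (auto simp: coalgebra_iff simp del: coalgebra.simps)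
  obtain h k where hk: "s = Sq f g h k" "square f g h k"
    using s pq by (auto simp: hom_arrow_cat)
  \<comment> \<open>The given embedding structures must be the ones built from \<open>x\<close> and
    \<open>y\<close>, by \<open>emb_unique\<close>.\<close>
  have r: "r = mmult T (Dom C f) \<cdot> far T (coalg_unit f x)"
    "t = mmult T (Dom C g) \<cdot> far T (coalg_unit g y)"
    using emb_unique[OF T_functor] p' pq' Lcoalg_emb[OF a(2)] Lcoalg_emb[OF b(2)] by auto
  have "coalgebra_hom (arrow_cat C) (Lcomonad C A) p q s \<longleftrightarrow> y \<cdot> k = Kmap f g h k \<cdot> x"
    unfolding pq a b hk coalgebra_hom_iff using hk(2) by simp
  also have "\<dots> \<longleftrightarrow> far T h \<cdot> r = t \<cdot> far T k"
  proof
    assume "y \<cdot> k = Kmap f g h k \<cdot> x"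
    then show "far T h \<cdot> r = t \<cdot> far T k"
      unfolding r using Lcoalg_hom_emb[OF a(2) b(2) hk(2)] by simp
  next
    assume "far T h \<cdot> r = t \<cdot> far T k"
    \<comment> \<open>\<open>emb_hom_Lcoalg\<close> only provides some structures \<open>x'\<close>
      and \<open>y'\<close>; by \<open>Lcoalg_unique\<close> they are \<open>x\<close> and
      \<open>y\<close>.\<close>
    then obtain x' y' where "Lcoalg f x'" "Lcoalg g y'" "y' \<cdot> k = Kmap f g h k \<cdot> x'"
      using emb_hom_Lcoalg[OF c sl _ _ hk(2), of r t] p' pq' unfolding is_L_coalgebra_hom_iff by blast
    then show "y \<cdot> k = Kmap f g h k \<cdot> x"
      using Lcoalg_unique a(2) b(2) by metis
  qed
  finally show "coalgebra_hom (arrow_cat C) (Lcomonad C A) p q s =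
      (case p' of (f, r) \<Rightarrow> \<lambda>(g, t) s. far T (up s) \<cdot> r = t \<cdot> far T (dn s)) q' s"
    by (simp add: pq' hk)
qed

lemma kz_reflective_if_cancellative:
  assumes c: "cancellative C A" and sl: "sub_lari C A"
  shows "kz_reflective C A"
proof -
  have "has_right_adjoint (emb_cat C T) (arrow_cat C) (forgetful fst)"
  proof (rule has_right_adjoint_iso_over[OF _ _ coalg_iso_emb[OF c sl]])
    show "x \<in> Obj (emb_cat C T) \<and> y \<in> Obj (emb_cat C T)" if "f \<in> hom (emb_cat C T) x y" for f x y
      using that by (auto simp: emb_cat_def over_cat_hom)
    show "ofunctor (coalg_cat (arrow_cat C) (Lcomonad C A)) (arrow_cat C) (forgetful fst)"
      unfolding coalg_cat_def by (rule ofunctor_forgetful) auto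
    show "has_right_adjoint (coalg_cat (arrow_cat C) (Lcomonad C A)) (arrow_cat C) (forgetful fst)"
      by (rule coalg_cat_has_right_adjoint[OF ord_category_arrow_cat L_comonad])
  qed
  then show ?thesis
    unfolding kz_reflective_def fibrantly_KZ_generating_def
    using T_monad T_lax coalg_iso_emb[OF c sl] by blast
qed

end

theorem theorem9p17:
  fixes C :: "('o, 'a) ocat" and A :: "('o, 'a) awfs"
  assumes "ord_category C"
    and "finitely_complete C"
    and "lofs C A"
    and "sub_lari C A"
  shows "cancellative C A \<longleftrightarrow> kz_reflective C A"
proof
  interpret lax_orthogonal C A
    using assms(1,3) by (simp add: lax_orthogonal_def lax_orthogonal_axioms_def)
  show "cancellative C A" if "kz_reflective C A"
    using that by (rule cancellative_if_kz_reflective)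
  obtain t where "t \<in> Obj C" "\<And>y. y \<in> Obj C \<Longrightarrow> \<exists>!h. h \<in> hom C y t"
    using finitely_complete_terminal[OF assms(2)] by blast
  then interpret lax_orthogonal_terminal C A t
    by unfold_locales
  show "kz_reflective C A" if "cancellative C A"
    using kz_reflective_if_cancellative[OF that assms(4)] .
qed

end
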